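(* In the fully synchronous model ($\mathcal{FSYNC}$), with no known bound on the ring size, Algorithm Unconscious Exploration (defined in the context) allows two anonymous agents without chirality to explore, without terminating, a 1-interval connected ring; the exploration is completed in $O(n)$ time, where $n$ is the ring size.
   Context: Ring: the nodes $v_0,\dots,v_{n-1}$ (indices modulo $n$) form a cycle; $v_i$ is linked to $v_{i-1}$ and $v_{i+1}$ via distinctly labelled ports $q_{i-}$ and $q_{i+}$ (labels need not be globally consistent). Time proceeds in rounds; in each round at most one edge, chosen by an adversary, is missing (1-interval connected ring). Nodes are anonymous (no distinguishable identifiers). Agents: each has memory and computational power; they are anonymous (no identifiers) and all execute the same protocol. They start at arbitrary, not necessarily distinct, nodes, cannot communicate explicitly and cannot mark nodes. Each agent $a_j$ has a consistent private orientation, i.e. a function $\lambda_j$ designating each port left or right with $\lambda_j(q_{i-})=\lambda_j(q_{k-})$ for all $i,k$. Without chirality, the orientations of different agents need not agree. Round: each active agent performs Look (it sees its own position within its node, i.e. whether it is on a port and which one, and the positions of the other agents at that node), Compute (from this snapshot and its memory it determines a direction in $\{left,right,nil\}$; if $nil$ it becomes inactive; otherwise it tries to access the corresponding port if not already there), and Move. Ports are accessed in mutual exclusion: an occupied port cannot be gained, and if several agents try the same port exactly one succeeds; an agent that fails sets $moved=false$ and becomes inactive. An agent on a port after computing moves to the other endpoint if the edge is present in this round (setting $moved=true$), and otherwise stays on the port (setting $moved=false$); in either case the port is denied to other agents in that round. Two agents crossing the same edge in opposite directions in the same round might not detect each other. $\mathcal{FSYNC}$: all agents are active in every round. Exploration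 is solved if within finite time every node is visited by at least one agent; here (unconscious exploration) the agents are not required to stop nor to be aware that the ring has been explored. Procedure Explore($dir$ | $p_1:s_1$; ...; $p_k:s_k$), with $dir\in\{left,right\}$ (in the agent's own orientation), predicates $p_i$ and states $s_i$: the agent performs Look, then evaluates $p_1,\dots,p_k$ in order; as soon as some $p_i$ is satisfied the procedure exits and the agent makes a transition to state $s_i$. If no predicate is satisfied, the agent tries to move in direction $dir$ and the procedure is executed again in the next round. Variables and predicates of an agent: $Etime$ is the number of rounds since the last call of Explore (made on entering a state); $Btime$ is the number of consecutive rounds the agent has currently been waiting in a port. "catches": the agent observes the other agent on the port corresponding to its own moving direction. "caught": the agent is on a port after a failed move and the other agent is observed in the node. Algorithm Unconscious Exploration (each agent starts in state Init). Let $L$ denote the list "$Etime\ge 2G$ and $Btime>G$: Reverse; $Etime\ge 2G$: Keep; catches: Bounce; caught: Forward". - State Init: $G\gets 2$, $dir\gets left$; Explore($dir$ | $L$). - State Reverse: $G\gets 2G$, $dir\gets$ opposite of $dir$; Explore($dir$ | $L$). - State Keep: $G\gets 2G$; Explore($dir$ | $L$). - State Bounce: Explore(opposite of $dir$), with no exit predicates. - State Forward: Explore($dir$), with no exit predicates. *)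

theory Defs
  imports Complex_Main "HOL-Library.Landau_Symbols"
begin

section \<open>Dynamic rings\<close>

text \<open>
  The nodes of the ring of size \<open>n\<close> are \<open>0, \<dots>, n - 1\<close>. The ports of node \<open>i\<close> leading to
  \<open>i - 1\<close> and \<open>i + 1\<close> are called \<open>Minus\<close> and \<open>Plus\<close>; edge \<open>i\<close> joins node \<open>i\<close> to
  node \<open>i + 1\<close> (modulo \<open>n\<close>). These names belong to the model only: agents never see them.
\<close>

datatype side = Minus | Plus

fun neighbour :: "nat \<Rightarrow> nat \<Rightarrow> side \<Rightarrow> nat" where
  "neighbour n i Plus = (i + 1) mod n"
| "neighbour n i Minus = (i + n - 1) mod n"

fun edge_at :: "nat \<Rightarrow> nat \<Rightarrow> side \<Rightarrow> nat" where
  "edge_at n i Plus = i"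
| "edge_at n i Minus = (i + n - 1) mod n"

text \<open>Position inside a node: in its interior or on one of its ports.\<close>

datatype 'p place = Inside | OnPort 'p

section \<open>Agents and the algorithm\<close>

datatype dir = Left | Right

fun opposite :: "dir \<Rightarrow> dir" where
  "opposite Left = Right"
| "opposite Right = Left"

text \<open>What an agent sees, in terms of its own orientation; \<open>other_place = None\<close> means that the
  other agent is not at the same node.\<close>

record snapshot =
  own_place :: "dir place"
  other_place :: "dir place option"

datatype state = Init | Reverse | Keep | Bounce | Forward

text \<open>\<open>guess\<close> and \<open>heading\<close> are the variables \<open>G\<close> and \<open>dir\<close> of the algorithm.\<close>

record memory =
  state :: state
  guess :: nat
  heading :: dir
  Etime :: nat
  Btime :: nat
  moved :: bool

definition initial_memory :: memory where
  "initial_memory = \<lparr>state = Init, guess = 2, heading = Left, Etime = 0, Btime = 0, moved = True\<rparr>"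

text \<open>The argument \<open>dir\<close> of the call of Explore made in each state.\<close>

fun explore_dir :: "state \<Rightarrow> dir \<Rightarrow> dir" where
  "explore_dir Bounce d = opposite d"
| "explore_dir _ d = d"

definition catches :: "snapshot \<Rightarrow> memory \<Rightarrow> bool" where
  "catches S m \<longleftrightarrow> other_place S = Some (OnPort (explore_dir (state m) (heading m)))"

definition caught :: "snapshot \<Rightarrow> memory \<Rightarrow> bool" where
  "caught S m \<longleftrightarrow> (\<exists>p. own_place S = OnPort p) \<and> \<not> moved m \<and> other_place S \<noteq> None"

type_synonym exits = "((snapshot \<Rightarrow> memory \<Rightarrow> bool) \<times> state) list"

definition standard_exits :: exits where
  "standard_exits =
    [(\<lambda>S m. Etime m \<ge> 2 * guess m \<and> Btime m > guess m, Reverse),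
     (\<lambda>S m. Etime m \<ge> 2 * guess m, Keep),
     (catches, Bounce),
     (caught, Forward)]"

fun explore_exits :: "state \<Rightarrow> exits" where
  "explore_exits Bounce = []"
| "explore_exits Forward = []"
| "explore_exits _ = standard_exits"

fun first_exit :: "exits \<Rightarrow> snapshot \<Rightarrow> memory \<Rightarrow> state option" where
  "first_exit [] S m = None"
| "first_exit ((p, s) # ps) S m = (if p S m then Some s else first_exit ps S m)"

fun entry_action :: "state \<Rightarrow> memory \<Rightarrow> memory" where
  "entry_action Reverse m = m\<lparr>guess := 2 * guess m, heading := opposite (heading m)\<rparr>"
| "entry_action Keep m = m\<lparr>guess := 2 * guess m\<rparr>"
| "entry_action _ m = m"

definition enter :: "state \<Rightarrow> memory \<Rightarrow> memory" where
  "enter s m = (entry_action s m)\<lparr>state := s, Etime := 0\<rparr>"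

text \<open>
  One Compute phase: the snapshot is tested against the exit predicates of the current state once.
  After a transition the agent already moves in this round as prescribed by the new state, whose
  own exit predicates are tested from the next round's Look on. The result \<open>None\<close> of the second
  component stands for the direction \<open>nil\<close>.
\<close>

definition compute :: "snapshot \<Rightarrow> memory \<Rightarrow> memory \<times> dir option" where
  "compute S m =
    (let m' = (case first_exit (explore_exits (state m)) S m of None \<Rightarrow> m | Some s \<Rightarrow> enter s m)
     in (m', Some (explore_dir (state m') (heading m'))))"

section \<open>Fully synchronous executions of two agents\<close>

text \<open>
  The two agents are indexed by \<open>bool\<close>, so that the agent other than \<open>a\<close> is \<open>\<not> a\<close>. The index is
  not available to \<open>compute\<close>. The private orientation of an agent assigns \<open>Left\<close> and \<open>Right\<close> to the
  two ports in the same way at every node, hence it is a bijection from \<open>side\<close> to \<open>dir\<close>; nothing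
  relates the orientations of the two agents.
\<close>

record agent =
  node :: nat
  place :: "side place"
  mem :: memory

type_synonym config = "bool \<Rightarrow> agent"
type_synonym orientations = "bool \<Rightarrow> side \<Rightarrow> dir"

definition look :: "orientations \<Rightarrow> config \<Rightarrow> bool \<Rightarrow> snapshot" where
  "look \<sigma> c a =
    \<lparr>own_place = map_place (\<sigma> a) (place (c a)),
     other_place = (if node (c (\<not> a)) = node (c a)
                    then Some (map_place (\<sigma> a) (place (c (\<not> a)))) else None)\<rparr>"

definition new_memory :: "orientations \<Rightarrow> config \<Rightarrow> bool \<Rightarrow> memory" where
  "new_memory \<sigma> c a = fst (compute (look \<sigma> c a) (mem (c a)))"

definition decision :: "orientations \<Rightarrow> config \<Rightarrow> bool \<Rightarrow> dir option" where
  "decision \<sigma> c a = snd (compute (look \<sigma> c a) (mem (c a)))"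

definition request :: "orientations \<Rightarrow> config \<Rightarrow> bool \<Rightarrow> side option" where
  "request \<sigma> c a = map_option (inv (\<sigma> a)) (decision \<sigma> c a)"

text \<open>
  Mutual exclusion: the requests of a round are served one after the other, in an order chosen by
  the adversary. A request fails iff the other agent is on the requested port at that moment; a
  failing agent keeps its place.
\<close>

definition serve :: "orientations \<Rightarrow> config \<Rightarrow> bool \<Rightarrow> (bool \<Rightarrow> side place) \<Rightarrow> (bool \<Rightarrow> side place)" where
  "serve \<sigma> c a P =
    (case request \<sigma> c a of
       None \<Rightarrow> P
     | Some p \<Rightarrow> if node (c (\<not> a)) = node (c a) \<and> P (\<not> a) = OnPort p then P else P(a := OnPort p))"

definition places_after_access :: "orientations \<Rightarrow> bool \<Rightarrow> config \<Rightarrow> bool \<Rightarrow> side place" where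
  "places_after_access \<sigma> first c = serve \<sigma> c (\<not> first) (serve \<sigma> c first (\<lambda>a. place (c a)))"

text \<open>The edge crossed by the agent unless it is missing; \<open>None\<close> if it did not gain its port.\<close>

definition attempted_side :: "orientations \<Rightarrow> bool \<Rightarrow> config \<Rightarrow> bool \<Rightarrow> side option" where
  "attempted_side \<sigma> first c a =
    (case request \<sigma> c a of
       None \<Rightarrow> None
     | Some p \<Rightarrow> if places_after_access \<sigma> first c a = OnPort p then Some p else None)"

fun next_Btime :: "side place \<Rightarrow> side place \<Rightarrow> nat \<Rightarrow> nat" where
  "next_Btime old Inside b = 0"
| "next_Btime old (OnPort p) b = (if old = OnPort p then b + 1 else 1)"

definition stay :: "orientations \<Rightarrow> bool \<Rightarrow> config \<Rightarrow> bool \<Rightarrow> agent" where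
  "stay \<sigma> first c a =
    (let m = new_memory \<sigma> c a; q = places_after_access \<sigma> first c a in
     \<lparr>node = node (c a), place = q,
      mem = m\<lparr>Etime := Etime m + 1, Btime := next_Btime (place (c a)) q (Btime m), moved := False\<rparr>\<rparr>)"

definition traverse :: "nat \<Rightarrow> orientations \<Rightarrow> config \<Rightarrow> bool \<Rightarrow> side \<Rightarrow> agent" where
  "traverse n \<sigma> c a p =
    (let m = new_memory \<sigma> c a in
     \<lparr>node = neighbour n (node (c a)) p, place = Inside,
      mem = m\<lparr>Etime := Etime m + 1, Btime := 0, moved := True\<rparr>\<rparr>)"

text \<open>The edge \<open>missing\<close> is absent in the round; \<open>None\<close> means that all edges are present.\<close>

definition one_round :: "nat \<Rightarrow> orientations \<Rightarrow> nat option \<Rightarrow> bool \<Rightarrow> config \<Rightarrow> config" where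
  "one_round n \<sigma> missing first c = (\<lambda>a.
    case attempted_side \<sigma> first c a of
      None \<Rightarrow> stay \<sigma> first c a
    | Some p \<Rightarrow> if missing = Some (edge_at n (node (c a)) p) then stay \<sigma> first c a
                else traverse n \<sigma> c a p)"

definition initial_config :: "(bool \<Rightarrow> nat) \<Rightarrow> config" where
  "initial_config start = (\<lambda>a. \<lparr>node = start a, place = Inside, mem = initial_memory\<rparr>)"

text \<open>
  \<open>missing t\<close> and \<open>first t\<close> are the adversary's choices in round \<open>t\<close>. As these choices determine
  the execution, quantifying over all such sequences also covers adaptive adversaries.
\<close>

primrec execution ::
  "nat \<Rightarrow> orientations \<Rightarrow> (bool \<Rightarrow> nat) \<Rightarrow> (nat \<Rightarrow> nat option) \<Rightarrow> (nat \<Rightarrow> bool) \<Rightarrow> nat \<Rightarrow> config"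
where
  "execution n \<sigma> start missing first 0 = initial_config start"
| "execution n \<sigma> start missing first (Suc t) =
     one_round n \<sigma> (missing t) (first t) (execution n \<sigma> start missing first t)"

definition explored_by :: "nat \<Rightarrow> (nat \<Rightarrow> config) \<Rightarrow> nat \<Rightarrow> bool" where
  "explored_by n ex T \<longleftrightarrow> (\<forall>v<n. \<exists>t\<le>T. \<exists>a. node (ex t a) = v)"

text \<open>No agent ever stops, i.e. decides \<open>nil\<close>.\<close>

definition never_terminates :: "orientations \<Rightarrow> (nat \<Rightarrow> config) \<Rightarrow> bool" where
  "never_terminates \<sigma> ex \<longleftrightarrow> (\<forall>t a. decision \<sigma> (ex t) a \<noteq> None)"

end

theory Submission
  imports Defs
begin

text \<open>
  As long as neither agent has caught the other, both run through the same phases in lockstep. In a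
  phase whose guess is at least \<open>2 * n\<close>, agents with the same heading explore the ring, because in
  every round one of them moves. Agents with opposite headings are both stopped only when they wait
  at the two ends of the same edge; either they wait there until the end of the phase and both turn
  round, or they cross. In both cases they move apart from a common stretch of visited nodes, which
  grows in every round of the next phase until it is the whole ring.

  When the agents meet with one of them waiting on a port, the waiting agent enters \<open>Forward\<close>. The
  other one bounces, except when the waiting agent has just turned round; then the other one
  stays in the search while heading away from it. From then on the nodes between the two form a
  visited interval of the universal cover of the ring, at whose upper end is the agent in
  \<open>Forward\<close>, and the next phase with a large guess completes the exploration.
\<close>

section \<open>Unrolling the ring\<close>

fun flip :: "side \<Rightarrow> side" where
  "flip Plus = Minus"
| "flip Minus = Plus"

fun sign :: "side \<Rightarrow> int" where
  "sign Plus = 1"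
| "sign Minus = -1"

lemma flip_flip [simp]: "flip (flip s) = s"
  by (cases s) auto

lemma flip_neq [simp]: "flip s \<noteq> s" "s \<noteq> flip s"
  by (cases s; simp)+

lemma neq_iff_flip: "s \<noteq> u \<longleftrightarrow> s = flip u"
  by (cases s; cases u) auto

text \<open>The orientation of the universal cover depends on \<open>s\<close>: side \<open>s\<close> always leads upwards.\<close>

definition loc :: "nat \<Rightarrow> side \<Rightarrow> int \<Rightarrow> nat" where
  "loc n s z = nat ((sign s * z) mod int n)"

lemma int_loc: "n > 0 \<Longrightarrow> int (loc n s z) = (sign s * z) mod int n"
  unfolding loc_def by simp

lemma loc_eq_iff: "n > 0 \<Longrightarrow> loc n s z = loc n s z' \<longleftrightarrow> int n dvd z - z'"
proof -
  assume "n > 0"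
  then have "loc n s z = loc n s z' \<longleftrightarrow> (sign s * z) mod int n = (sign s * z') mod int n"
    by (metis int_loc of_nat_eq_iff)
  also have "\<dots> \<longleftrightarrow> int n dvd sign s * (z - z')"
    by (simp add: mod_eq_dvd_iff right_diff_distrib)
  also have "\<dots> \<longleftrightarrow> int n dvd z - z'"
    by (cases s) (auto simp: dvd_diff_commute)
  finally show ?thesis .
qed

lemma not_dvd_small:
  assumes "d \<noteq> 0" "\<bar>d\<bar> < int n"
  shows "\<not> int n dvd d"
  using dvd_imp_le_int[of d "int n"] assms by auto

lemma neighbour_loc:
  assumes "n > 0"
  shows "neighbour n (loc n s z) s = loc n s (z + 1)"
    and "neighbour n (loc n s z) (flip s) = loc n s (z - 1)"
proof -
  have *: "int (neighbour n (loc n s z) u) = (sign s * z + sign u) mod int n" for u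
  proof (cases u)
    case Plus
    then show ?thesis using assms by (simp add: int_loc zmod_int mod_simps add.commute)
  next
    case Minus
    have "int (loc n s z + n - 1) = int (loc n s z) + int n - 1" using assms by linarith
    then have "int (neighbour n (loc n s z) u) = (int (loc n s z) + int n - 1) mod int n"
      using Minus by (simp add: zmod_int)
    also have "\<dots> = (int (loc n s z) - 1) mod int n"
      by (metis add_diff_eq add.commute mod_add_self1)
    finally show ?thesis using assms Minus by (simp add: int_loc mod_simps)
  qed
  show "neighbour n (loc n s z) s = loc n s (z + 1)"
    using *[of s] int_loc[OF assms, of s "z + 1"]
    by (simp add: distrib_left flip: of_nat_eq_iff[where 'a = int])
  have "sign (flip s) = - sign s" by (cases s) auto
  then show "neighbour n (loc n s z) (flip s) = loc n s (z - 1)"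
    using *[of "flip s"] int_loc[OF assms, of s "z - 1"]
    by (simp add: right_diff_distrib flip: of_nat_eq_iff[where 'a = int])
qed

text \<open>In cover coordinates every edge can be named by its lower end. This puts the edges
  requested by two agents with opposite headings into the form that \<open>edge_loc_eq_iff\<close>
  compares.\<close>

lemma edge_loc_flip:
  assumes "n > 0"
  shows "edge_at n (loc n s z) (flip s) = edge_at n (loc n s (z - 1)) s"
proof (cases s)
  case Plus
  then show ?thesis using neighbour_loc(2)[OF assms, of Plus z] by simp
next
  case Minus
  then show ?thesis using neighbour_loc(1)[OF assms, of Minus "z - 1"] by simp
qed

lemma edge_loc_eq_iff:
  assumes "n > 0"
  shows "edge_at n (loc n s z) s = edge_at n (loc n s z') s \<longleftrightarrow> int n dvd z - z'"
proof (cases s)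
  case Plus
  then show ?thesis using loc_eq_iff[OF assms] by simp
next
  case Minus
  have "edge_at n (loc n s w) s = loc n s (w + 1)" for w
    using neighbour_loc(1)[OF assms, of Minus w] Minus by simp
  then show ?thesis using loc_eq_iff[OF assms] by simp
qed

text \<open>The free base \<open>b\<close> allows a representative in any window of length
  \<open>n\<close>; \<open>lockstep_facing\<close> takes one just above a given point.\<close>

lemma loc_surj:
  assumes "v < n"
  obtains z where "b \<le> z" "z < b + int n" "loc n s z = v"
proof -
  \<comment> \<open>The least point from \<open>b\<close> on that is congruent to
    \<open>sign s * int v\<close>; as the sign squares to 1, multiplying by it leads back to
    \<open>v\<close>.\<close>
  let ?z = "b + (sign s * int v - b) mod int n"
  have "int n > 0" using assms by simp
  then have 1: "b \<le> ?z" "?z < b + int n" by (auto intro: pos_mod_bound)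
  have "sign s * ?z mod int n = int v"
  proof -
    have "int n dvd ?z - sign s * int v"
      by (metis add.commute diff_diff_eq2 dvd_minus_mod dvd_diff_commute)
    then have "int n dvd sign s * (?z - sign s * int v)" by (rule dvd_mult)
    moreover have "sign s * (?z - sign s * int v) = sign s * ?z - int v"
      by (cases s) (auto simp: algebra_simps)
    ultimately have "int n dvd sign s * ?z - int v" by metis
    then have "sign s * ?z mod int n = int v mod int n" by (simp only: mod_eq_dvd_iff)
    then show ?thesis using assms by (metis mod_less of_nat_mod)
  qed
  then have "loc n s ?z = v" unfolding loc_def by simp
  with 1 that show ?thesis by blast
qed

section \<open>One round of an execution\<close>

locale ring_execution =
  fixes n :: nat and \<sigma> :: orientations and start :: "bool \<Rightarrow> nat"
    and missing :: "nat \<Rightarrow> nat option" and first :: "nat \<Rightarrow> bool"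
  assumes two_le_n: "2 \<le> n"
    and bij_orientation: "bij (\<sigma> a)"
    and start_less: "start a < n"
begin

abbreviation config_at :: "nat \<Rightarrow> config" where
  "config_at t \<equiv> execution n \<sigma> start missing first t"

definition N :: "nat \<Rightarrow> bool \<Rightarrow> nat" where "N t a = node (config_at t a)"
definition Pl :: "nat \<Rightarrow> bool \<Rightarrow> side place" where "Pl t a = place (config_at t a)"
definition G :: "nat \<Rightarrow> bool \<Rightarrow> nat" where "G t a = guess (mem (config_at t a))"
definition E :: "nat \<Rightarrow> bool \<Rightarrow> nat" where "E t a = Etime (mem (config_at t a))"
definition B :: "nat \<Rightarrow> bool \<Rightarrow> nat" where "B t a = Btime (mem (config_at t a))"

definition searching :: "nat \<Rightarrow> bool \<Rightarrow> bool" where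
  "searching t a \<longleftrightarrow> state (mem (config_at t a)) \<in> {Init, Reverse, Keep}"

text \<open>\<open>H (Suc t) a\<close> is the side that agent \<open>a\<close> requests in round \<open>t\<close>.\<close>

definition H :: "nat \<Rightarrow> bool \<Rightarrow> side" where
  "H t a = inv (\<sigma> a) (explore_dir (state (mem (config_at t a))) (heading (mem (config_at t a))))"

definition gains :: "nat \<Rightarrow> bool \<Rightarrow> bool" where
  "gains t a \<longleftrightarrow> places_after_access \<sigma> (first t) (config_at t) a = OnPort (H (Suc t) a)"

lemma n_pos: "n > 0"
  using two_le_n by simp

lemma config_Suc:
  "config_at (Suc t) a = stay \<sigma> (first t) (config_at t) a \<or>
   (\<exists>p. config_at (Suc t) a = traverse n \<sigma> (config_at t) a p)"
  by (auto simp: one_round_def split: option.split)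

lemma mem_Suc:
  "state (mem (config_at (Suc t) a)) = state (new_memory \<sigma> (config_at t) a)"
  "heading (mem (config_at (Suc t) a)) = heading (new_memory \<sigma> (config_at t) a)"
  "guess (mem (config_at (Suc t) a)) = guess (new_memory \<sigma> (config_at t) a)"
  "Etime (mem (config_at (Suc t) a)) = Suc (Etime (new_memory \<sigma> (config_at t) a))"
  using config_Suc[of t a] by (auto simp: stay_def traverse_def Let_def)

text \<open>Move changes only the counters and \<open>moved\<close>, so the state and heading behind
  a request can be read off the next configuration. There is always a request because
  \<open>compute\<close> never yields \<open>nil\<close>.\<close>

lemma request_eq: "request \<sigma> (config_at t) a = Some (H (Suc t) a)"
  unfolding request_def decision_def H_def mem_Suc
  by (simp add: new_memory_def compute_def Let_def)

text \<open>Entering a state resets \<open>Etime\<close> only, so a wait on an unchanged port is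
  counted across the end of a phase.\<close>

lemma Btime_new_memory: "Btime (new_memory \<sigma> (config_at t) a) = B t a"
proof -
  have "Btime (enter s m) = Btime m" for s m
    by (cases s) (auto simp: enter_def)
  then show ?thesis
    by (auto simp: new_memory_def compute_def Let_def B_def split: option.split)
qed

lemma attempted_eq:
  "attempted_side \<sigma> (first t) (config_at t) a = (if gains t a then Some (H (Suc t) a) else None)"
  by (simp add: attempted_side_def request_eq gains_def)

lemma moves:
  assumes "gains t a" "missing t \<noteq> Some (edge_at n (N t a) (H (Suc t) a))"
  shows "N (Suc t) a = neighbour n (N t a) (H (Suc t) a)" "Pl (Suc t) a = Inside"
    "B (Suc t) a = 0"
  using assms by (simp_all add: N_def Pl_def B_def one_round_def attempted_eq traverse_def Let_def)

lemma stays: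
  assumes "\<not> gains t a \<or> missing t = Some (edge_at n (N t a) (H (Suc t) a))"
  shows "config_at (Suc t) a = stay \<sigma> (first t) (config_at t) a"
  using assms by (auto simp: N_def one_round_def attempted_eq)

lemma blocked:
  assumes "gains t a" "missing t = Some (edge_at n (N t a) (H (Suc t) a))"
  shows "N (Suc t) a = N t a" "Pl (Suc t) a = OnPort (H (Suc t) a)"
    "B (Suc t) a = (if Pl t a = OnPort (H (Suc t) a) then B t a + 1 else 1)"
proof -
  note st = stays[OF disjI2, OF assms(2)]
  have q: "places_after_access \<sigma> (first t) (config_at t) a = OnPort (H (Suc t) a)"
    using assms(1) by (simp add: gains_def)
  show "N (Suc t) a = N t a"
    using st by (simp add: N_def stay_def Let_def)
  show "Pl (Suc t) a = OnPort (H (Suc t) a)"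
    unfolding Pl_def st using q by (simp add: stay_def Let_def)
  show "B (Suc t) a = (if Pl t a = OnPort (H (Suc t) a) then B t a + 1 else 1)"
    unfolding B_def[of "Suc t"] st using q
    by (simp add: stay_def Let_def Pl_def Btime_new_memory)
qed

section \<open>Mutual exclusion on the ports\<close>

lemma serve_eq:
  "serve \<sigma> (config_at t) a P =
    (if N t (\<not> a) = N t a \<and> P (\<not> a) = OnPort (H (Suc t) a) then P
     else P(a := OnPort (H (Suc t) a)))"
  by (simp add: serve_def request_eq N_def)

lemma places_after_eq:
  "places_after_access \<sigma> (first t) (config_at t) =
    serve \<sigma> (config_at t) (\<not> first t) (serve \<sigma> (config_at t) (first t) (Pl t))"
  by (simp add: places_after_access_def Pl_def[abs_def])

lemma fails:
  assumes "\<not> gains t a"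
  shows "N (Suc t) a = N t a" "Pl (Suc t) a = Pl t a"
proof -
  note st = stays[OF disjI1, OF assms]
  show "N (Suc t) a = N t a"
    using st by (simp add: N_def stay_def Let_def)
  have "places_after_access \<sigma> (first t) (config_at t) a = Pl t a"
    using assms unfolding gains_def places_after_eq serve_eq
    by (cases a; cases "first t") (auto split: if_splits)
  then show "Pl (Suc t) a = Pl t a"
    unfolding Pl_def[of "Suc t"] st by (simp add: stay_def Let_def)
qed

text \<open>Only the companion standing on the requested port can shut an agent out. At a common
  node it neither starts there nor asks for that port, so the order of service is
  irrelevant.\<close>

lemma gains_if_free:
  assumes "N t a \<noteq> N t (\<not> a) \<or>
    H (Suc t) a \<noteq> H (Suc t) (\<not> a) \<and> Pl t (\<not> a) \<noteq> OnPort (H (Suc t) a)"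
  shows "gains t a"
  using assms unfolding gains_def places_after_eq serve_eq
  by (cases a; cases "first t") (auto split: if_splits)

text \<open>The first agent served takes the port, unless the companion already holds it; then the
  companion keeps it in either order.\<close>

lemma contention:
  assumes "N t a = N t (\<not> a)" "H (Suc t) a = H (Suc t) (\<not> a)" "Pl t a = Inside"
  shows "gains t a \<longleftrightarrow> \<not> gains t (\<not> a)"
    and "Pl t (\<not> a) = OnPort (H (Suc t) a) \<Longrightarrow> gains t (\<not> a)"
  using assms unfolding gains_def places_after_eq serve_eq
  by (cases a; cases "first t"; auto split: if_splits)+

text \<open>A traversal ends inside a node, so a place on a port already witnesses a failed move.
  Hence \<open>caught\<close> depends on the positions alone.\<close>

lemma on_port_not_moved: "Pl t a \<noteq> Inside \<Longrightarrow> \<not> moved (mem (config_at t a))"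
proof (induction t)
  case 0
  then show ?case by (simp add: Pl_def initial_config_def)
next
  case (Suc t)
  show ?case
    using config_Suc[of t a] Suc.prems by (auto simp: Pl_def stay_def traverse_def Let_def)
qed

lemma Inside_B: "Pl t a = Inside \<Longrightarrow> B t a = 0"
proof (induction t)
  case 0
  then show ?case by (simp add: B_def initial_config_def initial_memory_def)
next
  case (Suc t)
  show ?case
    using config_Suc[of t a] Suc.prems by (auto simp: Pl_def B_def stay_def traverse_def Let_def)
qed

lemma inv_orientation_opposite: "inv (\<sigma> a) (opposite d) = flip (inv (\<sigma> a) d)"
proof -
  have bij': "bij (inv (\<sigma> a))" by (rule bij_imp_bij_inv[OF bij_orientation])
  have "opposite d \<noteq> d" by (cases d) auto
  then have "inv (\<sigma> a) (opposite d) \<noteq> inv (\<sigma> a) d"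
    using bij' by (metis bij_def inj_eq)
  then show ?thesis by (simp add: neq_iff_flip)
qed

lemma catches_iff:
  "catches (look \<sigma> (config_at t) a) (mem (config_at t a)) \<longleftrightarrow>
    N t a = N t (\<not> a) \<and> Pl t (\<not> a) = OnPort (H t a)"
proof -
  have inj: "\<sigma> a x = y \<longleftrightarrow> x = inv (\<sigma> a) y" for x y
    using bij_orientation[of a] by (metis bij_inv_eq_iff)
  have "map_place (\<sigma> a) q = OnPort y \<longleftrightarrow> q = OnPort (inv (\<sigma> a) y)" for q y
    by (cases q) (auto simp: inj)
  then show ?thesis
    by (auto simp: catches_def look_def N_def Pl_def H_def)
qed

lemma caught_iff:
  "caught (look \<sigma> (config_at t) a) (mem (config_at t a)) \<longleftrightarrow>
    N t a = N t (\<not> a) \<and> Pl t a \<noteq> Inside"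
proof -
  have "(\<exists>p. map_place (\<sigma> a) q = OnPort p) \<longleftrightarrow> q \<noteq> Inside" for q :: "side place"
    by (cases q) auto
  then show ?thesis
    using on_port_not_moved[of t a] by (auto simp: caught_def look_def N_def Pl_def)
qed

section \<open>Transitions of a searching agent\<close>

lemma exits_searching:
  assumes "searching t a"
  shows "explore_exits (state (mem (config_at t a))) = standard_exits"
  using assms by (auto simp: searching_def)

lemma explore_dir_searching:
  assumes "searching t a"
  shows "explore_dir (state (mem (config_at t a))) d = d"
  using assms by (auto simp: searching_def)

lemma not_searching_Suc:
  assumes "\<not> searching t a"
  shows "\<not> searching (Suc t) a" "H (Suc t) a = H t a"
proof -
  have "explore_exits (state (mem (config_at t a))) = []"
    using assms unfolding searching_def by (cases "state (mem (config_at t a))") auto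
  then have "new_memory \<sigma> (config_at t) a = mem (config_at t a)"
    by (simp add: new_memory_def compute_def Let_def)
  then show "\<not> searching (Suc t) a" "H (Suc t) a = H t a"
    using assms unfolding searching_def H_def mem_Suc by simp_all
qed

text \<open>The two exits on \<open>Etime\<close> come first in the list, so a phase that is over
  ends even if the agents meet. The reset to 0 is followed by the count of the same round, hence the
  value 1.\<close>

lemma phase_end:
  assumes "searching t a" "2 * G t a \<le> E t a"
  shows "searching (Suc t) a" "G (Suc t) a = 2 * G t a" "E (Suc t) a = 1"
    "H (Suc t) a = (if B t a > G t a then flip (H t a) else H t a)"
  using assms(2)
  unfolding searching_def H_def G_def E_def B_def mem_Suc
  by (auto simp: new_memory_def compute_def Let_def exits_searching[OF assms(1)] explore_dir_searching[OF assms(1)]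
      standard_exits_def enter_def inv_orientation_opposite)

lemma catching:
  assumes "searching t a" "E t a < 2 * G t a" "N t a = N t (\<not> a)" "Pl t (\<not> a) = OnPort (H t a)"
  shows "\<not> searching (Suc t) a" "H (Suc t) a = flip (H t a)"
proof -
  have "catches (look \<sigma> (config_at t) a) (mem (config_at t a))"
    using catches_iff assms by blast
  then show "\<not> searching (Suc t) a" "H (Suc t) a = flip (H t a)"
    using assms(2)
    unfolding searching_def H_def G_def E_def mem_Suc
    by (auto simp: new_memory_def compute_def Let_def exits_searching[OF assms(1)] explore_dir_searching[OF assms(1)]
        standard_exits_def enter_def inv_orientation_opposite)
qed

lemma being_caught:
  assumes "searching t a" "E t a < 2 * G t a" "N t a = N t (\<not> a)"
    "Pl t (\<not> a) \<noteq> OnPort (H t a)" "Pl t a \<noteq> Inside"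
  shows "\<not> searching (Suc t) a" "H (Suc t) a = H t a"
proof -
  have "\<not> catches (look \<sigma> (config_at t) a) (mem (config_at t a))"
    "caught (look \<sigma> (config_at t) a) (mem (config_at t a))"
    using catches_iff caught_iff assms by blast+
  then show "\<not> searching (Suc t) a" "H (Suc t) a = H t a"
    using assms(2)
    unfolding searching_def H_def G_def E_def mem_Suc
    by (auto simp: new_memory_def compute_def Let_def exits_searching[OF assms(1)] explore_dir_searching[OF assms(1)]
        standard_exits_def enter_def inv_orientation_opposite)
qed

lemma continuing:
  assumes "searching t a" "E t a < 2 * G t a"
    "N t a \<noteq> N t (\<not> a) \<or> Pl t (\<not> a) \<noteq> OnPort (H t a) \<and> Pl t a = Inside"
  shows "searching (Suc t) a" "G (Suc t) a = G t a" "E (Suc t) a = Suc (E t a)"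
    "H (Suc t) a = H t a"
proof -
  have "\<not> catches (look \<sigma> (config_at t) a) (mem (config_at t a))"
    "\<not> caught (look \<sigma> (config_at t) a) (mem (config_at t a))"
    using catches_iff caught_iff assms by blast+
  then have "new_memory \<sigma> (config_at t) a = mem (config_at t a)"
    using assms(2) by (auto simp: G_def E_def new_memory_def compute_def Let_def 
        exits_searching[OF assms(1)] explore_dir_searching[OF assms(1)] standard_exits_def)
  then show "searching (Suc t) a" "G (Suc t) a = G t a" "E (Suc t) a = Suc (E t a)"
    "H (Suc t) a = H t a"
    using assms(1) unfolding searching_def H_def G_def E_def mem_Suc by simp_all
qed

lemma N_less: "N t a < n"
proof (induction t)
  case 0
  then show ?case using start_less by (simp add: N_def initial_config_def)
next
  case (Suc t)
  have "neighbour n v s < n" for v s using n_pos by (cases s) auto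
  then show ?case using moves(1)[of t a] blocked(1)[of t a] fails(1)[of t a] Suc by metis
qed

lemma obtain_loc:
  obtains x where "b \<le> x" "x < b + int n" "N t a = loc n s x"
  using loc_surj[OF N_less] by metis

lemma neighbour_neq: "neighbour n (N t a) s \<noteq> N t a"
proof -
  obtain x where x: "N t a = loc n s x" by (rule obtain_loc)
  show ?thesis
    using not_dvd_small[of 1 n] two_le_n by (simp add: x neighbour_loc n_pos loc_eq_iff)
qed

lemma edge_neighbour: "edge_at n (neighbour n (N t a) (flip s)) s = edge_at n (N t a) (flip s)"
proof -
  obtain x where x: "N t a = loc n s x" by (rule obtain_loc)
  show ?thesis by (simp add: x neighbour_loc n_pos edge_loc_flip)
qed

text \<open>On two nodes both ports lead to the same neighbour, yet by different edges; a loop is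
  excluded by \<open>two_le_n\<close>.\<close>

lemma edges_distinct: "s \<noteq> u \<Longrightarrow> edge_at n (N t a) s \<noteq> edge_at n (N t a) u"
proof -
  assume "s \<noteq> u"
  then have u: "u = flip s" using neq_iff_flip by metis
  obtain x where x: "N t a = loc n s x" by (rule obtain_loc)
  show ?thesis
    using not_dvd_small[of 1 n] two_le_n
    by (simp add: x u edge_loc_flip edge_loc_eq_iff n_pos)
qed

lemma neighbour_inj: "neighbour n (N t a) s = neighbour n (N t b) s \<Longrightarrow> N t a = N t b"
proof -
  assume *: "neighbour n (N t a) s = neighbour n (N t b) s"
  obtain x where x: "N t a = loc n s x" by (rule obtain_loc)
  obtain y where y: "N t b = loc n s y" by (rule obtain_loc)
  show ?thesis using * by (simp add: x y neighbour_loc n_pos loc_eq_iff)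
qed

section \<open>Visited intervals of the universal cover\<close>

definition explored :: "nat \<Rightarrow> bool" where
  "explored t \<longleftrightarrow> explored_by n config_at t"

definition seen :: "side \<Rightarrow> nat \<Rightarrow> int \<Rightarrow> int \<Rightarrow> bool" where
  "seen s t y x \<longleftrightarrow> (\<forall>z\<in>{y..x}. \<exists>t'\<le>t. \<exists>a. N t' a = loc n s z)"

lemma explored_mono: "explored t \<Longrightarrow> t \<le> t' \<Longrightarrow> explored t'"
  unfolding explored_def explored_by_def by (meson le_trans)

lemma seen_full: "seen s t y x \<Longrightarrow> int n - 1 \<le> x - y \<Longrightarrow> explored t"
  unfolding explored_def explored_by_def
proof (intro allI impI)
  fix v assume *: "seen s t y x" "int n - 1 \<le> x - y" "v < n"
  obtain z where "y \<le> z" "z < y + int n" "loc n s z = v" by (rule loc_surj[OF \<open>v < n\<close>])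
  then show "\<exists>t'\<le>t. \<exists>a. node (config_at t' a) = v"
    using * unfolding seen_def N_def by (metis atLeastAtMost_iff diff_le_eq le_diff_eq zle_diff1_eq
        add.commute order_trans diff_add_eq)
qed

lemma seen_here: "N t a = loc n s x \<Longrightarrow> seen s t x x"
  unfolding seen_def by auto

text \<open>Each end moves outwards by at most one, so a point outside the old interval is an end of
  the new one, where an agent stands now.\<close>

lemma seen_extend:
  assumes "seen s t y x" "N (Suc t) a = loc n s x'" "N (Suc t) b = loc n s y'"
    "x' \<le> x + 1" "y - 1 \<le> y'"
  shows "seen s (Suc t) y' x'"
  unfolding seen_def
proof
  fix z assume z: "z \<in> {y'..x'}"
  consider "z = x'" | "z = y'" | "z \<in> {y..x}" using z assms(4,5) by force
  then show "\<exists>t'\<le>Suc t. \<exists>a. N t' a = loc n s z"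
  proof cases
    case 3
    then show ?thesis using assms(1) unfolding seen_def by (meson le_SucI)
  qed (use assms(2,3) in auto)
qed

lemma seen_grow:
  assumes "seen s t y x" "N (Suc t) a = loc n s x'" "x' \<le> x + 1"
  shows "seen s (Suc t) y x'"
  unfolding seen_def
proof
  fix z assume "z \<in> {y..x'}"
  then consider "z = x'" | "z \<in> {y..x}" using assms(3) by force
  then show "\<exists>t'\<le>Suc t. \<exists>a. N t' a = loc n s z"
  proof cases
    case 2
    then show ?thesis using assms(1) unfolding seen_def by (meson le_SucI)
  qed (use assms(2) in auto)
qed

lemma advance:
  assumes "gains t a" "N t a = loc n s x" "H (Suc t) a = s"
  obtains (move) "missing t \<noteq> Some (edge_at n (loc n s x) s)" "N (Suc t) a = loc n s (x + 1)"
      "Pl (Suc t) a = Inside" "B (Suc t) a = 0"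
  | (block) "missing t = Some (edge_at n (loc n s x) s)" "N (Suc t) a = loc n s x"
      "Pl (Suc t) a = OnPort s" "B (Suc t) a = (if Pl t a = OnPort s then B t a + 1 else 1)"
  using moves[OF assms(1)] blocked[OF assms(1)] neighbour_loc(1)[OF n_pos]
  unfolding assms(2,3) by metis

lemma retreat:
  assumes "gains t a" "N t a = loc n s x" "H (Suc t) a = flip s"
  obtains (move) "missing t \<noteq> Some (edge_at n (loc n s (x - 1)) s)" "N (Suc t) a = loc n s (x - 1)"
      "Pl (Suc t) a = Inside" "B (Suc t) a = 0"
  | (block) "missing t = Some (edge_at n (loc n s (x - 1)) s)" "N (Suc t) a = loc n s x"
      "Pl (Suc t) a = OnPort (flip s)" "B (Suc t) a = (if Pl t a = OnPort (flip s) then B t a + 1 else 1)"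
  using moves[OF assms(1)] blocked[OF assms(1)] neighbour_loc(2)[OF n_pos]
  unfolding assms(2,3) edge_loc_flip[OF n_pos] by metis

text \<open>The agents push over the edge above \<open>x\<close> and the edge below
  \<open>y\<close>. With at most \<open>n - 1\<close> points from \<open>y\<close> to
  \<open>x\<close> these edges differ, so at most one is missing and the interval gains a
  point.\<close>

lemma diverge:
  assumes "gains t f" "gains t (\<not> f)" "N t f = loc n s x" "N t (\<not> f) = loc n s y"
    and "H (Suc t) f = s" "H (Suc t) (\<not> f) = flip s"
    and "y \<le> x" "x - y \<le> int n - 2" "seen s t y x"
  obtains x' y' where "N (Suc t) f = loc n s x'" "N (Suc t) (\<not> f) = loc n s y'"
    "x - y + 1 \<le> x' - y'" "x \<le> x'" "x' \<le> x + 1" "seen s (Suc t) y' x'"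
proof -
  have "\<not> int n dvd x - (y - 1)" using assms(7,8) by (intro not_dvd_small) auto
  then have e: "edge_at n (loc n s x) s \<noteq> edge_at n (loc n s (y - 1)) s"
    using edge_loc_eq_iff[OF n_pos] by blast
  note ext = seen_extend[OF assms(9)]
  show ?thesis
  proof (cases rule: advance[OF assms(1,3,5)])
    case f: 1
    show ?thesis
    proof (cases rule: retreat[OF assms(2,4,6)])
      case 1
      then show ?thesis using f ext[of f "x + 1" "\<not> f" "y - 1"] that[of "x + 1" "y - 1"] by simp
    next
      case 2
      then show ?thesis using f ext[of f "x + 1" "\<not> f" y] that[of "x + 1" y] by simp
    qed
  next
    case f: 2
    show ?thesis
    proof (cases rule: retreat[OF assms(2,4,6)])
      case 1
      then show ?thesis using f ext[of f x "\<not> f" "y - 1"] that[of x "y - 1"] by simp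
    next
      case 2
      then show ?thesis using f e by simp
    qed
  qed
qed

section \<open>Agents searching in lockstep\<close>

text \<open>A phase with guess \<open>g\<close> lasts \<open>2 * g\<close> rounds, so the phases
  before it take 4 + 8 + ... + g = 2 * g - 4 rounds. The equation states that \<open>E\<close>
  counts the rounds since then. The lower bound on \<open>E\<close> makes the phase unique at a
  boundary.\<close>

definition clock :: "nat \<Rightarrow> bool \<Rightarrow> bool" where
  "clock t a \<longleftrightarrow> E t a \<le> 2 * G t a \<and> t + 4 = 2 * G t a + E t a \<and> (\<exists>k. G t a = 2 ^ k) \<and>
    (0 < t \<longrightarrow> 1 \<le> E t a)"

lemma clock_Suc:
  assumes "searching t a" "clock t a" "searching (Suc t) a"
  shows "clock (Suc t) a"
proof (cases "2 * G t a \<le> E t a")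
  case True
  obtain k where "G t a = 2 ^ k" using assms(2) by (auto simp: clock_def)
  then have "2 * G t a = 2 ^ Suc k" "1 \<le> G t a" by simp_all
  then have "\<exists>k. 2 * G t a = 2 ^ k" "1 \<le> G t a" by blast+
  then show ?thesis using assms(2) True phase_end[OF assms(1) True] by (simp add: clock_def)
next
  case False
  then have "E t a < 2 * G t a" by simp
  then show ?thesis
    using assms catching(1)[of t a] being_caught(1)[of t a] continuing[of t a]
    unfolding clock_def by (metis Suc_leI add_Suc add_Suc_right le_add1 plus_1_eq_Suc)
qed

text \<open>For \<open>0 < t\<close> the clock puts \<open>t + 4\<close> strictly above
  \<open>2 * G\<close> and at most at \<open>4 * G\<close>. These ranges are disjoint for distinct
  powers of two, so the round number alone fixes guess and \<open>Etime\<close>.\<close>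

lemma clock_unique:
  assumes "clock t a" "t + 3 = 2 * 2 ^ k + j" "j < 2 * 2 ^ k" "0 < t"
  shows "G t a = 2 ^ k" "E t a = j + 1"
proof -
  obtain i where i: "G t a = 2 ^ i" using assms(1) by (auto simp: clock_def)
  have E: "E t a \<le> 2 * 2 ^ i" "t + 4 = 2 * 2 ^ i + E t a" "1 \<le> E t a"
    using assms(1,4) i by (auto simp: clock_def)
  have "2 * 2 ^ m \<le> (2 ^ l :: nat)" if "m < l" for m l
    using power_increasing[of "Suc m" l "2 :: nat"] that by simp
  then have "\<not> i < k" "\<not> k < i" using E assms(2,3) by fastforce+
  then have "i = k" by simp
  then show "G t a = 2 ^ k" "E t a = j + 1" using i E assms(2) by auto
qed

text \<open>The exception \<open>E t a = 1\<close>: when a phase ends, the blocked agent may turn round just as the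
  other one arrives behind it, and then be blocked again on its new port while the arriving agent
  has not gained the port it has given up.\<close>

definition places_ok :: "nat \<Rightarrow> bool" where
  "places_ok t \<longleftrightarrow> (\<forall>a.
    (\<forall>s. Pl t a = OnPort s \<longrightarrow> H t a = s) \<and>
    (N t a = N t (\<not> a) \<longrightarrow>
      (Pl t a = Inside \<or> Pl t (\<not> a) = Inside) \<and>
      (\<forall>s. Pl t (\<not> a) = OnPort s \<longrightarrow> H t a = s \<or> E t a = 1) \<and>
      (0 < t \<longrightarrow> Pl t a = Inside \<longrightarrow> Pl t (\<not> a) = Inside \<longrightarrow> H t a \<noteq> H t (\<not> a))))"

text \<open>With both ports gained, the missing edge decides everything. Two agents waiting at one
  node would need two missing edges; an agent arriving against a waiting one would have crossed the
  missing edge; two arriving with the same heading would come from one node.\<close>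

lemma places_ok_Suc_free:
  assumes g: "\<And>a. gains t a" and d: "\<And>a. N t a = N t (\<not> a) \<Longrightarrow> H (Suc t) a \<noteq> H (Suc t) (\<not> a)"
  shows "places_ok (Suc t)"
proof -
  have port: "H (Suc t) a = s \<and> N (Suc t) a = N t a \<and> missing t = Some (edge_at n (N t a) s)"
    if "Pl (Suc t) a = OnPort s" for a s
    using moves[OF g, of a] blocked[OF g, of a] that by (metis place.distinct(1) place.inject)
  have inside: "N (Suc t) a = neighbour n (N t a) (H (Suc t) a) \<and>
      missing t \<noteq> Some (edge_at n (N t a) (H (Suc t) a))"
    if "Pl (Suc t) a = Inside" for a
    using moves[OF g, of a] blocked[OF g, of a] that by (metis place.distinct(1))
  have one: "Pl (Suc t) a = Inside \<or> Pl (Suc t) (\<not> a) = Inside"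
    if same: "N (Suc t) a = N (Suc t) (\<not> a)" for a
  proof (rule ccontr)
    assume "\<not> ?thesis"
    then obtain s u where "Pl (Suc t) a = OnPort s" "Pl (Suc t) (\<not> a) = OnPort u"
      by (metis place.exhaust)
    from this[THEN port] show False using same d[of a] edges_distinct[of s u t a] by auto
  qed
  have behind: "H (Suc t) a = s"
    if same: "N (Suc t) a = N (Suc t) (\<not> a)" and s: "Pl (Suc t) (\<not> a) = OnPort s" for a s
  proof (rule ccontr)
    assume "H (Suc t) a \<noteq> s"
    then have u: "H (Suc t) a = flip s" using neq_iff_flip by metis
    have "Pl (Suc t) a = Inside" using one[OF same] s by simp
    then show False
      using inside[of a] port[OF s] same edge_neighbour[of t a s] u by metis
  qed
  have apart: "H (Suc t) a \<noteq> H (Suc t) (\<not> a)"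
    if "N (Suc t) a = N (Suc t) (\<not> a)" "Pl (Suc t) a = Inside" "Pl (Suc t) (\<not> a) = Inside" for a
    using inside[OF that(2)] inside[OF that(3)] that(1) neighbour_inj[of t a _ "\<not> a"] d[of a] by metis
  show ?thesis unfolding places_ok_def using port one behind apart by blast
qed

lemma places_ok_Suc_fail:
  assumes same: "N t a = N t (\<not> a)" and a: "Pl t a = Inside" "\<not> gains t a" and g: "gains t (\<not> a)"
    and h: "H (Suc t) a = H (Suc t) (\<not> a) \<or> E (Suc t) a = 1"
  shows "places_ok (Suc t)"
proof -
  have a': "Pl (Suc t) a = Inside" "N (Suc t) a = N t a" using fails[OF a(2)] a(1) by simp_all
  consider "N (Suc t) (\<not> a) \<noteq> N t a" "Pl (Suc t) (\<not> a) = Inside"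
    | "N (Suc t) (\<not> a) = N t a" "Pl (Suc t) (\<not> a) = OnPort (H (Suc t) (\<not> a))"
    using moves[OF g] blocked[OF g] same neighbour_neq by metis
  then show ?thesis
  proof cases
    case 1
    show ?thesis unfolding places_ok_def
    proof
      fix b
      have "b = a \<or> b = (\<not> a)" by auto
      then show "(\<forall>s. Pl (Suc t) b = OnPort s \<longrightarrow> H (Suc t) b = s) \<and>
        (N (Suc t) b = N (Suc t) (\<not> b) \<longrightarrow>
          (Pl (Suc t) b = Inside \<or> Pl (Suc t) (\<not> b) = Inside) \<and>
          (\<forall>s. Pl (Suc t) (\<not> b) = OnPort s \<longrightarrow> H (Suc t) b = s \<or> E (Suc t) b = 1) \<and>
          (0 < Suc t \<longrightarrow> Pl (Suc t) b = Inside \<longrightarrow> Pl (Suc t) (\<not> b) = Inside \<longrightarrow>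
            H (Suc t) b \<noteq> H (Suc t) (\<not> b)))"
        using 1 a' by auto
    qed
  next
    case 2
    show ?thesis unfolding places_ok_def
    proof
      fix b
      have "b = a \<or> b = (\<not> a)" by auto
      then show "(\<forall>s. Pl (Suc t) b = OnPort s \<longrightarrow> H (Suc t) b = s) \<and>
        (N (Suc t) b = N (Suc t) (\<not> b) \<longrightarrow>
          (Pl (Suc t) b = Inside \<or> Pl (Suc t) (\<not> b) = Inside) \<and>
          (\<forall>s. Pl (Suc t) (\<not> b) = OnPort s \<longrightarrow> H (Suc t) b = s \<or> E (Suc t) b = 1) \<and>
          (0 < Suc t \<longrightarrow> Pl (Suc t) b = Inside \<longrightarrow> Pl (Suc t) (\<not> b) = Inside \<longrightarrow>
            H (Suc t) b \<noteq> H (Suc t) (\<not> b)))"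
        using 2 a' h by auto
    qed
  qed
qed

lemma places_ok_Suc:
  assumes "N t a \<noteq> N t (\<not> a) \<or>
    Pl t a = Inside \<and> (\<forall>u. Pl t (\<not> a) = OnPort u \<longrightarrow> H (Suc t) a = u \<and> E (Suc t) a = 1)"
  shows "places_ok (Suc t)"
proof (cases "N t a = N t (\<not> a)")
  case False
  have "N t b \<noteq> N t (\<not> b)" for b using False by (cases "b = a") auto
  then show ?thesis by (intro places_ok_Suc_free gains_if_free) auto
next
  case True
  then have a: "Pl t a = Inside"
    and b: "\<And>u. Pl t (\<not> a) = OnPort u \<Longrightarrow> H (Suc t) a = u \<and> E (Suc t) a = 1"
    using assms by auto
  show ?thesis
  proof (cases "H (Suc t) a = H (Suc t) (\<not> a)")
    case same: True
    show ?thesis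
    proof (cases "gains t a")
      case False
      then show ?thesis using places_ok_Suc_fail[OF True a] contention(1)[OF True same a] same by blast
    next
      case g: True
      then have "\<not> gains t (\<not> a)" using contention(1)[OF True same a] by simp
      moreover from this have "Pl t (\<not> a) = Inside"
        using contention(2)[OF True same a] b by (cases "Pl t (\<not> a)") auto
      ultimately show ?thesis using places_ok_Suc_fail[of t "\<not> a"] True same g by simp
    qed
  next
    case False
    have gb: "gains t (\<not> a)" using False a by (intro gains_if_free) auto
    show ?thesis
    proof (cases "gains t a")
      case g: True
      have "gains t b" for b using g gb by (cases "b = a") auto
      moreover have "H (Suc t) b \<noteq> H (Suc t) (\<not> b)" for b using False by (cases "b = a") auto
      ultimately show ?thesis by (intro places_ok_Suc_free)
    next
      case ng: False
      \<comment> \<open>The companion gives up this port in the same round, but only after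
        \<open>a\<close> has been refused it: the exception of \<open>places_ok\<close>.\<close>
      then have "Pl t (\<not> a) = OnPort (H (Suc t) a)" using gains_if_free[of t a] False by blast
      then show ?thesis using places_ok_Suc_fail[OF True a ng gb] b by blast
    qed
  qed
qed

definition in_sync :: "nat \<Rightarrow> bool" where
  "in_sync t \<longleftrightarrow> (\<forall>a. searching t a \<and> clock t a \<and> G t a = G t (\<not> a)) \<and> places_ok t"

text \<open>Agent \<open>f\<close> heads for side \<open>s\<close> for good, and in unrolled coordinates all nodes from its
  companion at \<open>y\<close> up to \<open>f\<close> at \<open>x\<close> have been visited. The companion either heads the other way for good
  or still runs through the phases of the search.\<close>

definition one_way :: "nat \<Rightarrow> bool \<Rightarrow> side \<Rightarrow> int \<Rightarrow> int \<Rightarrow> bool" where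
  "one_way t f s x y \<longleftrightarrow> \<not> searching t f \<and> H t f = s \<and>
    N t f = loc n s x \<and> N t (\<not> f) = loc n s y \<and> y \<le> x \<and> seen s t y x \<and>
    (y = x \<longrightarrow> Pl t f = OnPort s \<and> Pl t (\<not> f) = Inside \<and> searching t (\<not> f) \<and> H t (\<not> f) = s) \<and>
    (if searching t (\<not> f) then clock t (\<not> f) else H t (\<not> f) = flip s)"

lemma in_sync_0: "in_sync 0"
proof -
  have "\<exists>k. 2 = (2 :: nat) ^ k" by (rule exI[of _ 1]) simp
  then show ?thesis
    by (simp add: in_sync_def places_ok_def clock_def searching_def E_def G_def Pl_def
        initial_config_def initial_memory_def)
qed

lemma in_sync_same_E: "in_sync t \<Longrightarrow> E t a = E t b \<and> G t a = G t b"
  unfolding in_sync_def clock_def by (cases a; cases b) (smt (verit) add_left_cancel)+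

lemma in_sync_meet:
  assumes sync: "in_sync t" and b: "E t b < 2 * G t b" "N t b = N t (\<not> b)" "Pl t b \<noteq> Inside"
  shows "\<not> searching (Suc t) b" "\<exists>f s x y. one_way (Suc t) f s x y"
proof -
  have E: "E t (\<not> b) < 2 * G t (\<not> b)" using in_sync_same_E[OF sync, of "\<not> b" b] b(1) by simp
  obtain s where s: "Pl t b = OnPort s" using b(3) by (cases "Pl t b") auto
  have se: "searching t b" "searching t (\<not> b)" "clock t (\<not> b)" using sync by (auto simp: in_sync_def)
  have p: "H t b = s" "Pl t (\<not> b) = Inside"
    using sync s b(2) unfolding in_sync_def places_ok_def by auto
  show fwd: "\<not> searching (Suc t) b" using being_caught(1)[OF se(1) b(1,2) _ b(3)] p by simp
  have Hb: "H (Suc t) b = s" using being_caught(2)[OF se(1) b(1,2) _ b(3)] p by simp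
  \<comment> \<open>Heading for the occupied port means bouncing. Otherwise, which
    \<open>places_ok\<close> permits only at \<open>E t (\<not> b) = 1\<close>, the agent already
    heads away and goes on searching.\<close>
  have "H (Suc t) (\<not> b) = flip s \<and> (searching (Suc t) (\<not> b) \<longrightarrow> clock (Suc t) (\<not> b))"
  proof (cases "H t (\<not> b) = s")
    case True
    then show ?thesis using catching[OF se(2) E] b(2) s by simp
  next
    case False
    then have "H t (\<not> b) = flip s" using neq_iff_flip by metis
    then show ?thesis
      using continuing(4)[OF se(2) E] s p clock_Suc[OF se(2,3)] by simp
  qed
  then have Ha: "H (Suc t) (\<not> b) = flip s" "searching (Suc t) (\<not> b) \<longrightarrow> clock (Suc t) (\<not> b)"
    by auto
  have g: "gains t b" "gains t (\<not> b)" using Ha(1) Hb p s by (auto intro!: gains_if_free)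
  obtain x where x: "N t b = loc n s x" by (rule obtain_loc)
  \<comment> \<open>The divergence starts from a one-node interval and yields
    \<open>y' < x'\<close>, so the clause of \<open>one_way\<close> for equal positions is
    void.\<close>
  obtain x' y' where "N (Suc t) b = loc n s x'" "N (Suc t) (\<not> b) = loc n s y'" "x - x + 1 \<le> x' - y'"
    "seen s (Suc t) y' x'"
    by (rule diverge[OF g x _ Hb Ha(1) order_refl _ seen_here[OF x]]) (use b(2) x two_le_n in auto)
  then have "one_way (Suc t) b s x' y'" using fwd Hb Ha by (simp add: one_way_def)
  then show "\<exists>f s x y. one_way (Suc t) f s x y" by blast
qed

lemma in_sync_Suc:
  assumes sync: "in_sync t"
  shows "in_sync (Suc t) \<or> (\<exists>f s x y. one_way (Suc t) f s x y)"
proof (cases "\<exists>b. E t b < 2 * G t b \<and> N t b = N t (\<not> b) \<and> Pl t b \<noteq> Inside")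
  case True
  then show ?thesis using in_sync_meet(2)[OF sync] by blast
next
  case no: False
  have se: "searching t a" "clock t a" for a using sync by (auto simp: in_sync_def)
  show ?thesis
  proof (cases "E t True < 2 * G t True")
    case True
    then have E: "E t a < 2 * G t a" for a using in_sync_same_E[OF sync, of a True] by simp
    have free: "N t a \<noteq> N t (\<not> a) \<or> Pl t a = Inside \<and> Pl t (\<not> a) = Inside" for a
      using no E[of a] E[of "\<not> a"] by auto
    then have "N t a \<noteq> N t (\<not> a) \<or> Pl t (\<not> a) \<noteq> OnPort (H t a) \<and> Pl t a = Inside" for a
      by (metis place.distinct(1))
    note c = continuing[OF se(1) E this]
    have "places_ok (Suc t)" using free[of True] by (intro places_ok_Suc[of t True]) auto
    then have "in_sync (Suc t)"
      unfolding in_sync_def using c(1) clock_Suc[OF se c(1)] c(2) in_sync_same_E[OF sync] by simp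
    then show ?thesis by simp
  next
    case False
    then have E: "2 * G t a \<le> E t a" for a using in_sync_same_E[OF sync, of a True] by simp
    note c = phase_end[OF se(1) E]
    \<comment> \<open>This switches off the exception of \<open>places_ok\<close>: an agent next to
      a waiting companion heads for the occupied port. Being inside it has waiting count 0, so it
      keeps that heading.\<close>
    have "E t a \<noteq> 1" for a
    proof -
      obtain k where "G t a = 2 ^ k" using se(2)[of a] by (auto simp: clock_def)
      then have "1 \<le> G t a" by simp
      then show ?thesis using E[of a] by linarith
    qed
    have "\<exists>a. N t a \<noteq> N t (\<not> a) \<or> Pl t a = Inside"
      using sync unfolding in_sync_def places_ok_def by blast
    then obtain a where a: "N t a \<noteq> N t (\<not> a) \<or> Pl t a = Inside" by blast
    have "H (Suc t) a = u" if "N t a = N t (\<not> a)" "Pl t (\<not> a) = OnPort u" for u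
    proof -
      have "H t a = u" using sync that \<open>E t a \<noteq> 1\<close> unfolding in_sync_def places_ok_def by blast
      then show ?thesis using c(4)[of a] Inside_B[of t a] a that by simp
    qed
    then have "places_ok (Suc t)" using a c(3)[of a] by (intro places_ok_Suc[of t a]) auto
    then have "in_sync (Suc t)"
      unfolding in_sync_def using c(1) clock_Suc[OF se c(1)] c(2) in_sync_same_E[OF sync] by simp
    then show ?thesis by simp
  qed
qed

section \<open>One agent committed to a direction\<close>

text \<open>Agents heading for the same side at different nodes face different edges, so one of them
  moves. A companion that has caught up bounces in the middle of a phase; at the end of a phase it
  keeps its heading and fails while \<open>f\<close> may stay blocked, so \<open>x + y\<close> need
  not grow in that round.\<close>

lemma one_way_Suc:
  assumes ow: "one_way t f s x y" and small: "x - y \<le> int n - 2"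
  obtains x' y' where "one_way (Suc t) f s x' y'" "x \<le> x'" "x' \<le> x + 1"
    "H (Suc t) (\<not> f) = flip s \<Longrightarrow> x - y + 1 \<le> x' - y'"
    "\<lbrakk>E t (\<not> f) < 2 * G t (\<not> f); H (Suc t) (\<not> f) = s\<rbrakk> \<Longrightarrow> x + y + 1 \<le> x' + y'"
proof -
  note found = that
  have f: "\<not> searching t f" "H t f = s" and N: "N t f = loc n s x" "N t (\<not> f) = loc n s y"
    and yx: "y \<le> x" and sn: "seen s t y x"
    and eq: "y = x \<Longrightarrow> Pl t f = OnPort s \<and> Pl t (\<not> f) = Inside \<and> searching t (\<not> f) \<and> H t (\<not> f) = s"
    and p: "if searching t (\<not> f) then clock t (\<not> f) else H t (\<not> f) = flip s"
    using ow unfolding one_way_def by blast+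
  have f': "\<not> searching (Suc t) f" "H (Suc t) f = s" using not_searching_Suc[OF f(1)] f(2) by auto
  have away: thesis
    if g: "gains t f" "gains t (\<not> f)" and h: "H (Suc t) (\<not> f) = flip s"
      and c: "searching (Suc t) (\<not> f) \<Longrightarrow> clock (Suc t) (\<not> f)"
  proof -
    obtain x' y' where "N (Suc t) f = loc n s x'" "N (Suc t) (\<not> f) = loc n s y'"
      "x - y + 1 \<le> x' - y'" "x \<le> x'" "x' \<le> x + 1" "seen s (Suc t) y' x'"
      by (rule diverge[OF g N f'(2) h yx small sn])
    then show thesis using found[of x' y'] f' h c yx by (simp add: one_way_def)
  qed
  show thesis
  proof (cases "y = x")
    case True
    note q = eq[OF True]
    then have se: "searching t (\<not> f)" "clock t (\<not> f)" using p by auto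
    have same: "N t (\<not> f) = N t (\<not> \<not> f)" using N True by simp
    show thesis
    proof (cases "E t (\<not> f) < 2 * G t (\<not> f)")
      case E: True
      note c = catching[OF se(1) E same]
      have "H (Suc t) (\<not> f) = flip s" "\<not> searching (Suc t) (\<not> f)" using c q by auto
      then show thesis using f' q by (intro away gains_if_free) auto
    next
      case False
      then have "2 * G t (\<not> f) \<le> E t (\<not> f)" by simp
      note c = phase_end[OF se(1) this]
      have h: "H (Suc t) (\<not> f) = s" using c(4) q Inside_B[of t "\<not> f"] by simp
      have g: "gains t f" "\<not> gains t (\<not> f)"
        using contention[OF same] h f' q by auto
      have p': "N (Suc t) (\<not> f) = loc n s y" "Pl (Suc t) (\<not> f) = Inside"
        using fails[OF g(2)] N q by auto
      note cl = clock_Suc[OF se c(1)]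
      show thesis
      proof (cases rule: advance[OF g(1) N(1) f'(2)])
        case 1
        then have "seen s (Suc t) y (x + 1)" using seen_extend[OF sn 1(2) p'(1)] by simp
        then have "one_way (Suc t) f s (x + 1) y"
          unfolding one_way_def using f' 1 p' yx cl c(1) by simp
        then show thesis using found[of "x + 1" y] by simp
      next
        case 2
        then have "seen s (Suc t) y x" using seen_extend[OF sn 2(2) p'(1)] by simp
        then have "one_way (Suc t) f s x y"
          unfolding one_way_def using f' 2 p' yx cl c(1) h by simp
        then show thesis using found[of x y] h False by simp
      qed
    qed
  next
    case False
    then have "\<not> int n dvd x - y" using yx small by (intro not_dvd_small) auto
    then have ne: "N t f \<noteq> N t (\<not> f)"
      and ed: "edge_at n (loc n s x) s \<noteq> edge_at n (loc n s y) s"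
      using N loc_eq_iff[OF n_pos] edge_loc_eq_iff[OF n_pos] by auto
    have g: "gains t f" "gains t (\<not> f)" using ne by (auto intro!: gains_if_free)
    have st: "searching (Suc t) (\<not> f)" if "searching t (\<not> f)"
      using phase_end(1)[OF that] continuing(1)[OF that] ne by force
    have cl: "clock (Suc t) (\<not> f)" if "searching (Suc t) (\<not> f)"
      using that clock_Suc[of t "\<not> f"] p not_searching_Suc(1)[of t "\<not> f"] by (metis (full_types))
    show thesis
    proof (cases "H (Suc t) (\<not> f) = flip s")
      case True
      then show thesis using away g cl by blast
    next
      case False
      then have h: "H (Suc t) (\<not> f) = s" using neq_iff_flip by metis
      have s': "searching (Suc t) (\<not> f)"
        using st p not_searching_Suc(2)[of t "\<not> f"] False by metis
      show thesis
      proof (cases rule: advance[OF g(1) N(1) f'(2)])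
        case f1: 1
        show thesis
        proof (cases rule: advance[OF g(2) N(2) h])
          case 1
          then have "seen s (Suc t) (y + 1) (x + 1)" using seen_extend[OF sn f1(2) 1(2)] by simp
          then have "one_way (Suc t) f s (x + 1) (y + 1)"
            unfolding one_way_def using f' f1 1 yx cl s' \<open>y \<noteq> x\<close> by simp
          then show thesis using found[of "x + 1" "y + 1"] h by simp
        next
          case 2
          then have "seen s (Suc t) y (x + 1)" using seen_extend[OF sn f1(2) 2(2)] by simp
          then have "one_way (Suc t) f s (x + 1) y"
            unfolding one_way_def using f' f1 2 yx cl s' \<open>y \<noteq> x\<close> by simp
          then show thesis using found[of "x + 1" y] h by simp
        qed
      next
        case f2: 2
        show thesis
        proof (cases rule: advance[OF g(2) N(2) h])
          case 1
          \<comment> \<open>Here the companion may catch up, \<open>y + 1 = x\<close>; then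
            \<open>f\<close> has just been blocked on side \<open>s\<close>, as
            \<open>one_way\<close> demands.\<close>
          then have "seen s (Suc t) (y + 1) x" using seen_extend[OF sn f2(2) 1(2)] by simp
          then have "one_way (Suc t) f s x (y + 1)"
            unfolding one_way_def using f' f2 1 yx cl s' h \<open>y \<noteq> x\<close> by simp
          then show thesis using found[of x "y + 1"] h by simp
        next
          case 2
          then show thesis using f2 ed by simp
        qed
      qed
    qed
  qed
qed

lemma one_way_small: "one_way t f s x y \<Longrightarrow> \<not> explored t \<Longrightarrow> x - y \<le> int n - 2"
  using seen_full[of s t y x] by (force simp: one_way_def)

lemma one_way_later:
  assumes "one_way t f s x y"
  shows "explored (t + k) \<or> (\<exists>x y. one_way (t + k) f s x y)"
proof (induction k)
  case 0
  then show ?case using assms by auto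
next
  case (Suc k)
  then show ?case
    using one_way_Suc one_way_small explored_mono[of "t + k" "t + Suc k"]
    by (metis add_Suc_right le_add2 plus_1_eq_Suc)
qed

lemma diverging_explored:
  assumes "one_way t f s x y" "\<not> searching t (\<not> f)"
  shows "explored (t + n)"
proof -
  have "explored (t + k) \<or>
    (\<exists>x y. one_way (t + k) f s x y \<and> \<not> searching (t + k) (\<not> f) \<and> int k \<le> x - y)" for k
  proof (induction k)
    case 0
    then show ?case using assms by (auto simp: one_way_def)
  next
    case (Suc k)
    show ?case
    proof (cases "explored (t + k)")
      case True
      then show ?thesis using explored_mono[of "t + k" "t + Suc k"] by simp
    next
      case False
      then obtain x y where ow: "one_way (t + k) f s x y" and p: "\<not> searching (t + k) (\<not> f)"
        and k: "int k \<le> x - y"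
        using Suc by blast
      note p' = not_searching_Suc[OF p]
      have "H (Suc (t + k)) (\<not> f) = flip s" using ow p p' by (simp add: one_way_def)
      then obtain x' y' where "one_way (Suc (t + k)) f s x' y'" "x - y + 1 \<le> x' - y'"
        using one_way_Suc[OF ow one_way_small[OF ow False]] by metis
      then show ?thesis using p' k by (intro disjI2 exI[of _ x'] exI[of _ y']) simp
    qed
  qed
  from this[of n] show ?thesis using seen_full[of s "t + n"] by (force simp: one_way_def)
qed

text \<open>While the companion heads for \<open>s\<close> as well, some agent moves in every round, so \<open>x + y\<close>
  grows; as \<open>y \<le> x\<close>, agent \<open>f\<close> alone would get round the ring. While it heads the other way,
  \<open>x - y\<close> grows.\<close>

lemma one_way_phase:
  assumes ow: "one_way t f s x0 y0" and p: "searching t (\<not> f)" "G t (\<not> f) = g" "E t (\<not> f) = 1"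
    and large: "2 * n \<le> g"
  shows "explored (t + (2 * g - 1) + n)"
proof (cases "explored t")
  case True
  then show ?thesis by (rule explored_mono) simp
next
  case not_yet: False
  define h where "h = H t (\<not> f)"
  \<comment> \<open>The trail of \<open>f\<close> from \<open>x0\<close> is recorded besides the
    interval from \<open>y\<close> to \<open>x\<close>, whose lower end rises with a companion
    heading for \<open>s\<close>.\<close>
  define progress where "progress k x y \<longleftrightarrow> searching (t + k) (\<not> f) \<and> G (t + k) (\<not> f) = g \<and>
      E (t + k) (\<not> f) = k + 1 \<and> H (t + k) (\<not> f) = h \<and> x0 \<le> x \<and> seen s (t + k) x0 x \<and>
      (if h = s then x0 + y0 + int k \<le> x + y else int k \<le> x - y)" for k x y
  have main: "explored (t + k) \<or> (\<exists>x y. one_way (t + k) f s x y \<and>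
      (\<not> searching (t + k) (\<not> f) \<or> progress k x y))" if "k \<le> 2 * g - 1" for k
    using that
  proof (induction k)
    case 0
    have "seen s t x0 x0" using ow by (intro seen_here[of t f]) (simp add: one_way_def)
    then have "progress 0 x0 y0" using ow p h_def by (auto simp: progress_def one_way_def)
    then show ?case using ow by auto
  next
    case (Suc k)
    show ?case
    proof (cases "explored (t + k)")
      case True
      then show ?thesis using explored_mono[of "t + k" "t + Suc k"] by simp
    next
      case False
      then obtain x y where ow: "one_way (t + k) f s x y"
        and pr: "\<not> searching (t + k) (\<not> f) \<or> progress k x y"
        using Suc by auto
      obtain x' y' where ow': "one_way (Suc (t + k)) f s x' y'" and x': "x \<le> x'" "x' \<le> x + 1"
        and apart: "H (Suc (t + k)) (\<not> f) = flip s \<Longrightarrow> x - y + 1 \<le> x' - y'"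
        and along: "\<lbrakk>E (t + k) (\<not> f) < 2 * G (t + k) (\<not> f); H (Suc (t + k)) (\<not> f) = s\<rbrakk> \<Longrightarrow>
          x + y + 1 \<le> x' + y'"
        using one_way_Suc[OF ow one_way_small[OF ow False]] by metis
      show ?thesis
      proof (cases "searching (Suc (t + k)) (\<not> f)")
        case False
        then show ?thesis using ow' by auto
      next
        case True
        then have s: "searching (t + k) (\<not> f)" and pr: "progress k x y"
          using pr not_searching_Suc(1)[of "t + k" "\<not> f"] by auto
        have E: "E (t + k) (\<not> f) < 2 * G (t + k) (\<not> f)" using pr Suc.prems by (simp add: progress_def)
        have "N (t + k) (\<not> f) \<noteq> N (t + k) (\<not> \<not> f) \<or>
          Pl (t + k) (\<not> \<not> f) \<noteq> OnPort (H (t + k) (\<not> f)) \<and> Pl (t + k) (\<not> f) = Inside"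
          using True catching(1)[OF s E] being_caught(1)[OF s E] by blast
        note c = continuing[OF s E this]
        have "seen s (Suc (t + k)) x0 x'"
        proof -
          have 1: "seen s (t + k) x0 x" "x0 \<le> x" using pr by (auto simp: progress_def)
          have "N (Suc (t + k)) f = loc n s x'" using ow' by (simp add: one_way_def)
          then show ?thesis using seen_grow[OF 1(1)] x' by blast
        qed
        then have "progress (Suc k) x' y'"
          using c pr x' apart along[OF E] neq_iff_flip[of s h] neq_iff_flip[of h s]
          by (auto simp: progress_def)
        then show ?thesis using ow' by auto
      qed
    qed
  qed
  show ?thesis
  proof (cases "explored (t + (2 * g - 1))")
    case True
    then show ?thesis by (rule explored_mono) simp
  next
    case False
    then obtain x y where ow': "one_way (t + (2 * g - 1)) f s x y"
      and pr: "\<not> searching (t + (2 * g - 1)) (\<not> f) \<or> progress (2 * g - 1) x y"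
      using main[of "2 * g - 1"] by auto
    have "explored (t + (2 * g - 1))" if "progress (2 * g - 1) x y"
    proof (cases "h = s")
      case True
      have "x0 - y0 \<le> int n - 2" by (rule one_way_small[OF ow not_yet])
      moreover have "x0 + y0 + int (2 * g - 1) \<le> x + y" "y \<le> x"
        using that True ow' by (auto simp: progress_def one_way_def)
      \<comment> \<open>Together with \<open>y0\<close> being at least \<open>x0 - (n - 2)\<close>,
        this gives \<open>2 * (x - x0)\<close> at least \<open>3 * n + 1\<close>.\<close>
      moreover have "4 * int n - 1 \<le> int (2 * g - 1)" using large by linarith
      ultimately have "int n - 1 \<le> x - x0" by linarith
      then show ?thesis using that seen_full[of s _ x0 x] by (simp add: progress_def)
    next
      case False
      then have "int n - 1 \<le> x - y" using that large two_le_n by (simp add: progress_def)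
      then show ?thesis using ow' seen_full[of s _ y x] by (simp add: one_way_def)
    qed
    then show ?thesis using pr False diverging_explored[OF ow'] by blast
  qed
qed

section \<open>Exploration in lockstep\<close>

text \<open>If the lockstep survives a round in the middle of a phase, agents at a common node are
  both inside it, and by \<open>places_ok\<close> they have opposite headings. Hence no port is
  contested. Round 0 is excluded since both may start alike at one node.\<close>

lemma in_sync_quiet:
  assumes "in_sync t" "in_sync (Suc t)" "0 < t" "E t a < 2 * G t a"
  shows "H (Suc t) a = H t a" "gains t a" "N t a = N t (\<not> a) \<Longrightarrow> H t a \<noteq> H t (\<not> a)"
proof -
  have E: "E t b < 2 * G t b" for b using assms(4) in_sync_same_E[OF assms(1), of a b] by simp
  have s: "searching t b" "searching (Suc t) b" for b using assms(1,2) by (auto simp: in_sync_def)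
  have inside: "Pl t b = Inside" if "N t b = N t (\<not> b)" for b
    using in_sync_meet(1)[OF assms(1) E that] s by blast
  have inside': "Pl t (\<not> b) = Inside" if "N t b = N t (\<not> b)" for b
    using inside[of "\<not> b"] that by simp
  have h: "H (Suc t) b = H t b" for b
    by (rule continuing(4)[OF s(1) E]) (use inside inside' in fastforce)
  then show "H (Suc t) a = H t a" by simp
  show differ: "H t a \<noteq> H t (\<not> a)" if "N t a = N t (\<not> a)"
    using assms(1,3) that inside[OF that] inside'[OF that] unfolding in_sync_def places_ok_def by blast
  show "gains t a"
    by (rule gains_if_free) (use differ h inside' in force)
qed

text \<open>Equal headings force different nodes, hence different edges, and \<open>x + y\<close>
  grows in every round. After at least \<open>4 * n - 1\<close> rounds one agent alone has gone
  round the ring.\<close>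

lemma lockstep_same_heading:
  assumes sync: "\<And>j. j \<le> 2 * 2 ^ k \<Longrightarrow> in_sync (t + j)"
    and t: "0 < t" "t + 3 = 2 * 2 ^ k" and large: "2 * n \<le> 2 ^ k"
    and h: "H t True = s" "H t False = s"
  shows "explored (t + (2 * 2 ^ k - 1))"
proof -
  obtain x0 where x0: "N t True = loc n s x0" by (rule obtain_loc)
  obtain y0 where y0: "N t False = loc n s y0" by (rule obtain_loc)
  have "\<exists>x y. N (t + j) True = loc n s x \<and> N (t + j) False = loc n s y \<and>
      seen s (t + j) x0 x \<and> seen s (t + j) y0 y \<and> x0 + y0 + int j \<le> x + y \<and> (\<forall>a. H (t + j) a = s)"
    if "j \<le> 2 * 2 ^ k - 1" for j
    using that
  proof (induction j)
    case 0
    have "H t a = s" for a using h by (cases a) auto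
    then show ?case using x0 y0 seen_here[OF x0] seen_here[OF y0]
      by (intro exI[of _ x0] exI[of _ y0]) simp
  next
    case (Suc j)
    then obtain x y where N: "N (t + j) True = loc n s x" "N (t + j) False = loc n s y"
      and sn: "seen s (t + j) x0 x" "seen s (t + j) y0 y" and le: "x0 + y0 + int j \<le> x + y"
      and h: "\<And>a. H (t + j) a = s" by auto
    have sy: "in_sync (t + j)" "in_sync (Suc (t + j))"
      using sync[of j] sync[of "Suc j"] Suc.prems by simp_all
    have "clock (t + j) a" for a using sy by (auto simp: in_sync_def)
    note cl = clock_unique[OF this, of k j]
    have E: "E (t + j) a < 2 * G (t + j) a" for a using cl t Suc.prems by simp
    note q = in_sync_quiet[OF sy _ E]
    have h': "H (Suc (t + j)) a = s" and g: "gains (t + j) a" for a using q(1,2) t h by auto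
    have "N (t + j) True \<noteq> N (t + j) False" using q(3)[of True] t h by auto
    then have ed: "edge_at n (loc n s x) s \<noteq> edge_at n (loc n s y) s"
      using N loc_eq_iff[OF n_pos] edge_loc_eq_iff[OF n_pos] by auto
    obtain x' where x': "N (Suc (t + j)) True = loc n s x'" "x' = x + 1 \<or>
        x' = x \<and> missing (t + j) = Some (edge_at n (loc n s x) s)"
      by (rule advance[OF g N(1) h']) blast+
    obtain y' where y': "N (Suc (t + j)) False = loc n s y'" "y' = y + 1 \<or>
        y' = y \<and> missing (t + j) = Some (edge_at n (loc n s y) s)"
      by (rule advance[OF g N(2) h']) blast+
    have "x + y + 1 \<le> x' + y'" using x'(2) y'(2) ed by auto
    moreover have "seen s (Suc (t + j)) x0 x'" using seen_grow[OF sn(1) x'(1)] x'(2) by auto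
    moreover have "seen s (Suc (t + j)) y0 y'" using seen_grow[OF sn(2) y'(1)] y'(2) by auto
    ultimately show ?case using x'(1) y'(1) h' le by (intro exI[of _ x'] exI[of _ y']) simp
  qed
  from this[of "2 * 2 ^ k - 1"] obtain x y where
    sn: "seen s (t + (2 * 2 ^ k - 1)) x0 x" "seen s (t + (2 * 2 ^ k - 1)) y0 y"
    and le: "x0 + y0 + int (2 * 2 ^ k - 1) \<le> x + y" by auto
  have "4 * int n - 1 \<le> int (2 * 2 ^ k - 1)" using large by linarith
  then have "int n - 1 \<le> x - x0 \<or> int n - 1 \<le> y - y0" using le by linarith
  then show ?thesis using sn seen_full by blast
qed

lemma lockstep_apart:
  assumes sync: "\<And>j. j \<le> n \<Longrightarrow> in_sync (t + j)"
    and t: "0 < t" "t + 3 = 2 * 2 ^ k" and large: "n \<le> 2 ^ k"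
    and h: "H t f = s" "H t (\<not> f) = flip s"
    and N0: "N t f = loc n s x0" "N t (\<not> f) = loc n s y0" "y0 \<le> x0" "seen s t y0 x0"
  shows "explored (t + n)"
proof -
  have "explored (t + j) \<or> (\<exists>x y. N (t + j) f = loc n s x \<and> N (t + j) (\<not> f) = loc n s y \<and>
      seen s (t + j) y x \<and> int j \<le> x - y \<and> H (t + j) f = s \<and> H (t + j) (\<not> f) = flip s)"
    if "j \<le> n" for j
    using that
  proof (induction j)
    case 0
    then show ?case using N0 h by auto
  next
    case (Suc j)
    show ?case
    proof (cases "explored (t + j)")
      case True
      then show ?thesis using explored_mono[of "t + j" "t + Suc j"] by simp
    next
      case False
      then obtain x y where N: "N (t + j) f = loc n s x" "N (t + j) (\<not> f) = loc n s y"
        and sn: "seen s (t + j) y x" and le: "int j \<le> x - y"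
        and h: "H (t + j) f = s" "H (t + j) (\<not> f) = flip s" using Suc by auto
      have sy: "in_sync (t + j)" "in_sync (Suc (t + j))"
        using sync[of j] sync[of "Suc j"] Suc.prems by simp_all
      have "clock (t + j) a" for a using sy by (auto simp: in_sync_def)
      note cl = clock_unique[OF this, of k j]
      have E: "E (t + j) a < 2 * G (t + j) a" for a using cl t Suc.prems large by simp
      note q = in_sync_quiet[OF sy _ E]
      have "H (Suc (t + j)) f = s" "H (Suc (t + j)) (\<not> f) = flip s" using q(1) t h by auto
      moreover have "gains (t + j) a" for a using q(2) t by auto
      moreover have "x - y \<le> int n - 2" using sn False seen_full by force
      ultimately obtain x' y' where "N (Suc (t + j)) f = loc n s x'"
        "N (Suc (t + j)) (\<not> f) = loc n s y'" "x - y + 1 \<le> x' - y'" "seen s (Suc (t + j)) y' x'"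
        using diverge[OF _ _ N _ _ _ _ sn] le by (metis diff_ge_0_iff_ge of_nat_0_le_iff order_trans)
      then show ?thesis
        using le \<open>H (Suc (t + j)) f = s\<close> \<open>H (Suc (t + j)) (\<not> f) = flip s\<close>
        by (intro disjI2 exI[of _ x'] exI[of _ y']) simp
    qed
  qed
  from this[of n] show ?thesis using seen_full[of s "t + n"] by force
qed

text \<open>The last two outcomes are a wait at both ends of one edge and a pair that has met or
  crossed. The bounds on \<open>B\<close> decide which agents turn when the phase ends.\<close>

lemma lockstep_facing:
  assumes sync: "\<And>j. j \<le> 2 * 2 ^ k \<Longrightarrow> in_sync (t + j)"
    and t: "0 < t" "t + 3 = 2 * 2 ^ k" and large: "2 * n \<le> 2 ^ k"
    and h0: "H t f = s" "H t (\<not> f) = flip s"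
  defines "u \<equiv> t + (2 * 2 ^ k - 1)"
  obtains "explored u"
  | x y where "N u f = loc n s x" "N u (\<not> f) = loc n s y" "H u f = s" "H u (\<not> f) = flip s"
    "x - y = -1" "\<And>a. 2 ^ k < B u a"
  | x y where "N u f = loc n s x" "N u (\<not> f) = loc n s y" "H u f = s" "H u (\<not> f) = flip s"
    "y \<le> x" "x - y \<le> int n - 2" "seen s u y x" "\<And>a. int (B u a) \<le> x - y"
proof -
  obtain x0 where x0: "N t f = loc n s x0" by (rule obtain_loc)
  \<comment> \<open>The companion is placed above \<open>f\<close>; distance \<open>n\<close> stands
    for a common node.\<close>
  obtain y0 where y0: "x0 + 1 \<le> y0" "y0 < x0 + 1 + int n" "N t (\<not> f) = loc n s y0"
    by (rule obtain_loc)
  \<comment> \<open>While approaching, the distance drops in every round from at most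
    \<open>n\<close>, so adjacency is reached by round \<open>n - 1\<close>, if not skipped; the
    agents then wait until they cross. After a meeting or crossing, each round adds at most one to
    \<open>B\<close> and at least one to \<open>x - y\<close>.\<close>
  define stage where "stage j x y \<longleftrightarrow>
     x - y \<le> -2 \<and> int j - int n \<le> x - y \<or>
     x - y = -1 \<and> (\<forall>a. j + 1 \<le> B (t + j) a + n) \<or>
     0 \<le> x - y \<and> seen s (t + j) y x \<and> (\<forall>a. int (B (t + j) a) \<le> x - y)" for j x y
  have main: "explored (t + j) \<or> (\<exists>x y. N (t + j) f = loc n s x \<and> N (t + j) (\<not> f) = loc n s y \<and>
      H (t + j) f = s \<and> H (t + j) (\<not> f) = flip s \<and> stage j x y)"
    if "j \<le> 2 * 2 ^ k - 1" for j
    using that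
  proof (induction j)
    case 0
    have "stage 0 x0 y0" using y0(1,2) two_le_n by (auto simp: stage_def)
    then show ?case using x0 y0(3) h0 by auto
  next
    case (Suc j)
    show ?case
    proof (cases "explored (t + j)")
      case True
      then show ?thesis using explored_mono[of "t + j" "t + Suc j"] by simp
    next
      case False
      then obtain x y where N: "N (t + j) f = loc n s x" "N (t + j) (\<not> f) = loc n s y"
        and h: "H (t + j) f = s" "H (t + j) (\<not> f) = flip s" and stage: "stage j x y"
        using Suc by auto
      let ?t = "t + j"
      have sy: "in_sync ?t" "in_sync (Suc ?t)"
        using sync[of j] sync[of "Suc j"] Suc.prems by simp_all
      have "clock ?t a" for a using sy by (auto simp: in_sync_def)
      note cl = clock_unique[OF this, of k j]
      have E: "E ?t a < 2 * G ?t a" for a using cl t Suc.prems by simp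
      note q = in_sync_quiet[OF sy _ E]
      have h': "H (Suc ?t) f = s" "H (Suc ?t) (\<not> f) = flip s" using q(1) t h by auto
      have g: "gains ?t a" for a using q(2) t by auto
      have all: "\<forall>a. P a" if "P f" "P (\<not> f)" for P
      proof
        fix a
        have "a = f \<or> a = (\<not> f)" by auto
        then show "P a" using that by (elim disjE) simp_all
      qed
      \<comment> \<open>An occupied port agrees with the heading, so another blocked round continues
        the count; from inside it starts with 1, which is \<open>0 + 1\<close>.\<close>
      have wait: "B (Suc ?t) a = B ?t a + 1" if "Pl (Suc ?t) a = OnPort (H ?t a)"
        "B (Suc ?t) a = (if Pl ?t a = OnPort (H ?t a) then B ?t a + 1 else 1)" for a
        using that sy(1) Inside_B[of ?t a] unfolding in_sync_def places_ok_def
        by (cases "Pl ?t a") auto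
      have "\<exists>x' y'. N (Suc ?t) f = loc n s x' \<and> N (Suc ?t) (\<not> f) = loc n s y' \<and> stage (Suc j) x' y'"
      proof (cases "0 \<le> x - y")
        case True
        then have sn: "seen s ?t y x" and Bt: "\<And>a. int (B ?t a) \<le> x - y"
          using stage by (auto simp: stage_def)
        have small: "x - y \<le> int n - 2" using sn False seen_full by force
        obtain x' y' where N': "N (Suc ?t) f = loc n s x'" "N (Suc ?t) (\<not> f) = loc n s y'"
          "x - y + 1 \<le> x' - y'" "seen s (Suc ?t) y' x'"
          by (rule diverge[OF g g N h' _ small sn]) (use True in auto)
        have "B (Suc ?t) a \<le> B ?t a + 1" for a
          using moves(3)[OF g, of a] blocked(3)[OF g, of a] 
          by (cases "missing ?t = Some (edge_at n (N ?t a) (H (Suc ?t) a))") (auto split: if_splits)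
        then have "int (B (Suc ?t) a) \<le> x' - y'" for a using Bt[of a] N'(3) 
          by (smt (verit) of_nat_1 of_nat_add of_nat_mono)
        then have "stage (Suc j) x' y'" using N'(3,4) True by (simp add: stage_def)
        then show ?thesis using N'(1,2) by blast
      next
        case neg: False
        have range: "- int n \<le> x - y" "x - y \<le> -1" using neg stage two_le_n by (auto simp: stage_def)
        have low: "x - y \<noteq> -1 \<Longrightarrow> int j - int n \<le> x - y" using neg stage by (auto simp: stage_def)
        have ed: "edge_at n (loc n s x) s = edge_at n (loc n s (y - 1)) s \<longleftrightarrow> x - y = -1"
        proof -
          have "edge_at n (loc n s x) s = edge_at n (loc n s (y - 1)) s \<longleftrightarrow> int n dvd x - y + 1"
            by (simp add: edge_loc_eq_iff[OF n_pos] algebra_simps)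
          also have "\<dots> \<longleftrightarrow> x - y = -1"
          proof
            assume "int n dvd x - y + 1"
            then show "x - y = -1" using not_dvd_small[of "x - y + 1" n] range by force
          qed simp
          finally show ?thesis .
        qed
        show ?thesis
        proof (cases rule: advance[OF g N(1) h'(1)])
          case f: 1
          show ?thesis
          proof (cases rule: retreat[OF g N(2) h'(2)])
            case p: 1
            have B0: "\<forall>a. B (Suc ?t) a = 0" using all[of "\<lambda>a. B (Suc ?t) a = 0"] f p by simp
            \<comment> \<open>When both move, the agents meet from difference -2 and cross from
              -1.\<close>
            have "stage (Suc j) (x + 1) (y - 1)"
            proof (cases "x - y \<le> -3")
              case True
              then show ?thesis using low B0 by (auto simp: stage_def)
            next
              case False
              then consider "x - y = -2" | "x - y = -1" using range by linarith
              then have "seen s (Suc ?t) (y - 1) (x + 1)"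
              proof cases
                case 1
                then have "y - 1 = x + 1" by simp
                then show ?thesis using seen_here[OF f(2)] by (simp only:)
              next
                case 2
                then have "y - 1 = x" by simp
                then show ?thesis using seen_grow[OF seen_here[OF N(1)] f(2)] by simp
              qed
              then show ?thesis using False B0 by (simp add: stage_def)
            qed
            then show ?thesis using f p by blast
          next
            case p: 2
            then have "x - y \<noteq> -1" using f ed by auto
            then have "stage (Suc j) (x + 1) y" using low range by (auto simp: stage_def)
            then show ?thesis using f p by blast
          qed
        next
          case f: 2
          show ?thesis
          proof (cases rule: retreat[OF g N(2) h'(2)])
            case p: 1
            then have "x - y \<noteq> -1" using f ed by auto
            then have "stage (Suc j) x (y - 1)" using low range by (auto simp: stage_def)
            then show ?thesis using f p by blast
          next
            case p: 2
            then have "x - y = -1" using f ed by auto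
            moreover have "\<forall>a. B (Suc ?t) a = B ?t a + 1"
              using wait[of f] wait[of "\<not> f"] f p h
              by (intro all) auto
            ultimately have "stage (Suc j) x y" using stage by (auto simp: stage_def)
            then show ?thesis using f p by blast
          qed
        qed
      qed
      then show ?thesis using h' by auto
    qed
  qed
  show thesis
  proof (cases "explored u")
    case True
    then show thesis by (rule that(1))
  next
    case False
    then obtain x y where N: "N u f = loc n s x" "N u (\<not> f) = loc n s y"
        and h: "H u f = s" "H u (\<not> f) = flip s" and stage: "stage (2 * 2 ^ k - 1) x y"
      using main[of "2 * 2 ^ k - 1"] by (auto simp: u_def)
    have "\<not> (int (2 * 2 ^ k - 1) - int n \<le> x - y \<and> x - y \<le> -2)" using large by linarith
    then consider "x - y = -1" "\<forall>a. 2 * 2 ^ k - 1 + 1 \<le> B u a + n" |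
      "0 \<le> x - y" "seen s u y x" "\<forall>a. int (B u a) \<le> x - y"
      using stage unfolding stage_def u_def by blast
    then show thesis
    proof cases
      case 1
      \<comment> \<open>At most \<open>n\<close> of the \<open>2 * 2 ^ k\<close> rounds are not
        counted as waiting, and \<open>n\<close> is at most half of \<open>2 ^ k\<close>.\<close>
      have "2 ^ k < B u a" for a using 1(2)[rule_format, of a] large two_le_n by linarith
      then show thesis using that(2)[OF N h 1(1)] by blast
    next
      case 2
      have "x - y \<le> int n - 2" using 2(2) False seen_full by force
      then show thesis using that(3)[OF N h] 2 by simp
    qed
  qed
qed

lemma lockstep_explored:
  assumes sync: "\<And>j. j \<le> 2 * 2 ^ k + n \<Longrightarrow> in_sync (t + j)"
    and t: "0 < t" "t + 3 = 2 * 2 ^ k" and large: "2 * n \<le> 2 ^ k"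
  shows "explored (t + 2 * 2 ^ k + n)"
proof (cases "H t True = H t False")
  case True
  then have "explored (t + (2 * 2 ^ k - 1))"
    using lockstep_same_heading[OF sync t large] by simp
  then show ?thesis by (rule explored_mono) simp
next
  case False
  define s where "s = H t True"
  have "H t False = flip s" using False neq_iff_flip unfolding s_def by metis
  then have h: "H t True = s" "H t (\<not> True) = flip s" by (simp_all add: s_def)
  define u where "u = t + (2 * 2 ^ k - 1)"
  have Su: "Suc u = t + 2 * 2 ^ k" by (simp add: u_def)
  have sy: "in_sync u" using sync[of "2 * 2 ^ k - 1"] by (simp add: u_def)
  have sy': "in_sync (Suc u + j)" if "j \<le> n" for j using sync[of "2 * 2 ^ k + j"] that by (simp add: Su add.assoc)
  have c: "searching u a" "clock u a" for a using sy by (auto simp: in_sync_def)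
  have E: "G u a = 2 ^ k" "2 * G u a \<le> E u a" for a
    using clock_unique[OF c(2), of k "2 * 2 ^ k - 1" a] t by (simp_all add: u_def)
  note pe = phase_end(4)[OF c(1) E(2)]
  have next_phase: "0 < Suc u" "Suc u + 3 = 2 * 2 ^ Suc k" using t by (simp_all add: Su)
  have large': "n \<le> 2 ^ Suc k" using large by simp
  \<comment> \<open>\<open>lockstep_apart\<close> starts at \<open>Suc u\<close>, so the round at
    \<open>u\<close>, in which the headings are chosen, is handled by
    \<open>diverge\<close>.\<close>
  have apart: "explored (t + 2 * 2 ^ k + n)" if h: "H (Suc u) f = r" "H (Suc u) (\<not> f) = flip r"
    and g: "gains u f" "gains u (\<not> f)"
    and N: "N u f = loc n r x" "N u (\<not> f) = loc n r y" "y \<le> x" "seen r u y x" for f r x y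
  proof (cases "x - y \<le> int n - 2")
    case True
    obtain x' y' where "N (Suc u) f = loc n r x'" "N (Suc u) (\<not> f) = loc n r y'"
      "x - y + 1 \<le> x' - y'" "seen r (Suc u) y' x'"
      using diverge[OF g N(1,2) h N(3) True N(4)] by metis
    then show ?thesis
      using lockstep_apart[OF sy' next_phase large' h] N(3) by (simp add: Su)
  next
    case False
    then have "explored u" using seen_full[OF N(4)] by simp
    then show ?thesis by (rule explored_mono) (simp add: u_def)
  qed
  show ?thesis
  proof (rule lockstep_facing[OF sync t large h, folded u_def])
    assume "explored u"
    then show ?thesis by (rule explored_mono) (simp add: u_def)
  next
    fix x y
    assume N: "N u True = loc n s x" "N u (\<not> True) = loc n s y"
      and hu: "H u True = s" "H u (\<not> True) = flip s" and d: "x - y = -1"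
      and Bu: "\<And>a. 2 ^ k < B u a"
    \<comment> \<open>Both turn round: \<open>False\<close>, waiting at \<open>y = x + 1\<close>,
      becomes the upper agent, and the seed interval is from \<open>x\<close> to
      \<open>x + 1\<close>.\<close>
    have h': "H (Suc u) False = s" "H (Suc u) (\<not> False) = flip s"
      using pe[of True] pe[of False] Bu hu E(1) by simp_all
    have "loc n s x \<noteq> loc n s y"
      using not_dvd_small[of "x - y" n] two_le_n d loc_eq_iff[OF n_pos] by simp
    then have ne: "N u a \<noteq> N u (\<not> a)" for a using N by (cases a) auto
    then have g: "gains u a" for a by (intro gains_if_free) simp
    have "seen s u x (x + 1)"
      unfolding seen_def
    proof
      fix z assume "z \<in> {x..x + 1}"
      then have "z = x \<or> z = y" using d by auto
      then show "\<exists>t'\<le>u. \<exists>a. N t' a = loc n s z" using N by blast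
    qed
    then show ?thesis using apart[OF h' g g] N d by (simp add: algebra_simps)
  next
    fix x y
    assume N: "N u True = loc n s x" "N u (\<not> True) = loc n s y"
      and hu: "H u True = s" "H u (\<not> True) = flip s" and d: "y \<le> x" "x - y \<le> int n - 2"
      and sn: "seen s u y x" and Bu: "\<And>a. int (B u a) \<le> x - y"
    \<comment> \<open>The count is at most \<open>n - 2\<close>, below the guess, so neither agent
      turns.\<close>
    have "\<not> 2 ^ k < B u a" for a using Bu[of a] d large by linarith
    then have h': "H (Suc u) a = H u a" for a using pe E(1) by simp
    have differ: "H u a \<noteq> H u (\<not> a)" for a using hu by (cases a) auto
    have "E u a \<noteq> 1" for a
      using E[of a] one_le_power[of "2 :: nat" k] by linarith
    then have "Pl u (\<not> a) \<noteq> OnPort v" if "N u a = N u (\<not> a)" for a v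
      using sy that differ[of a] unfolding in_sync_def places_ok_def by metis
    then have g: "gains u a" for a using differ h' by (intro gains_if_free) auto
    show ?thesis using apart[OF _ _ g g N d(1) sn] hu h' by simp
  qed simp
qed

text \<open>Take \<open>2 ^ k\<close> between \<open>2 * n\<close> and \<open>4 * n\<close>. A
  lockstep lasting until \<open>w\<close>, the start of the phase with guess
  \<open>2 ^ (k + 2)\<close>, has explored the ring; otherwise some agent is committed and that
  phase plus \<open>n\<close> rounds suffices. The total is below \<open>16 * 2 ^ k + n\<close>,
  whence 65.\<close>

lemma explored_linear: "explored (65 * n)"
proof -
  have "\<exists>k. 2 * n \<le> 2 ^ k \<and> 2 ^ k \<le> 4 * n"
  proof -
    obtain m where "2 ^ m \<le> 2 * n" "2 * n < 2 ^ (m + 1)"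
      using ex_power_ivl1[of 2 "2 * n"] two_le_n by auto
    then show ?thesis by (intro exI[of _ "m + 1"]) simp
  qed
  then obtain k :: nat where k: "2 * n \<le> 2 ^ k" "2 ^ k \<le> 4 * n" by blast
  define t where "t = 2 * 2 ^ k - (3 :: nat)"
  define w where "w = 2 * 2 ^ (k + 2) - (3 :: nat)"
  have t: "0 < t" "t + 3 = 2 * 2 ^ k" using k two_le_n by (auto simp: t_def)
  have w: "0 < w" "w + 3 = 2 * 2 ^ (k + 2)" "2 * n \<le> 2 ^ (k + 2)" using k two_le_n by (auto simp: w_def)
  have late: "w + (2 * 2 ^ (k + 2) - 1) + n \<le> 65 * n" using k w by simp
  have early: "t + 2 * 2 ^ k + n \<le> w" using t w(2) k by simp
  have trichotomy: "explored i \<or> in_sync i \<or> (\<exists>f s x y. one_way i f s x y)" for i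
  proof (induction i)
    case 0
    then show ?case using in_sync_0 by simp
  next
    case (Suc i)
    then show ?case
      using explored_mono[of i "Suc i"] in_sync_Suc one_way_later[of i _ _ _ _ 1] by fastforce
  qed
  show ?thesis
  proof (cases "explored w")
    case True
    then show ?thesis by (rule explored_mono) (use late k(1) two_le_n in linarith)
  next
    case False
    have "\<exists>f s x y. one_way w f s x y"
    proof (rule ccontr)
      assume no: "\<nexists>f s x y. one_way w f s x y"
      have "in_sync i" if "i \<le> w" for i
        using trichotomy[of i] explored_mono[of i w] one_way_later[of i _ _ _ _ "w - i"] no that False
        by fastforce
      then have "explored (t + 2 * 2 ^ k + n)"
        using early by (intro lockstep_explored[OF _ t k(1)]) simp
      then show False using explored_mono early False by blast
    qed
    then obtain f s x y where ow: "one_way w f s x y" by blast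
    have "explored (w + (2 * 2 ^ (k + 2) - 1) + n)"
    proof (cases "searching w (\<not> f)")
      case True
      then have "clock w (\<not> f)" using ow by (simp add: one_way_def)
      then show ?thesis
        using clock_unique[of w "\<not> f" "k + 2" 0] w by (intro one_way_phase[OF ow True]) simp_all
    next
      case False
      from diverging_explored[OF ow this] show ?thesis by (rule explored_mono) linarith
    qed
    then show ?thesis by (rule explored_mono) (rule late)
  qed
qed

end

lemma decision_not_None: "decision \<sigma> c a \<noteq> None"
  by (simp add: decision_def compute_def Let_def)

theorem theorem5:
  shows "\<exists>T :: nat \<Rightarrow> nat.
    (\<lambda>n. real (T n)) \<in> O(\<lambda>n. real n) \<and>
    (\<forall>n \<sigma> start missing first.
       n > 0 \<longrightarrow> (\<forall>a. bij (\<sigma> a)) \<longrightarrow> (\<forall>a. start a < n) \<longrightarrow>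
       explored_by n (execution n \<sigma> start missing first) (T n) \<and>
       never_terminates \<sigma> (execution n \<sigma> start missing first))"
proof (intro exI[of _ "\<lambda>n. 65 * n"] conjI allI impI)
  show "(\<lambda>n. real (65 * n)) \<in> O(\<lambda>n. real n)"
    by (rule bigoI[of _ 65]) simp
next
  fix n :: nat and \<sigma> :: orientations and start :: "bool \<Rightarrow> nat" and missing first
  assume n: "n > 0" and bij: "\<forall>a. bij (\<sigma> a)" and start: "\<forall>a. start a < n"
  show "never_terminates \<sigma> (execution n \<sigma> start missing first)"
    by (simp add: never_terminates_def decision_not_None)
  show "explored_by n (execution n \<sigma> start missing first) (65 * n)"
  \<comment> \<open>A single node is visited at time 0; the locale covers the rings with at least
    two nodes.\<close>
  proof (cases "n = 1")
    case True
    then show ?thesis using start by (auto simp: explored_by_def initial_config_def intro!: exI[of _ 0])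
  next
    case False
    then interpret ring_execution n \<sigma> start missing first
      by unfold_locales (use n bij start in auto)
    show ?thesis using explored_linear by (simp add: explored_def)
  qed
qed

end
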